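(* Suppose that $\sigma_r(\Sigma)>\sigma_{r+1}(\Sigma)$. Let $\widetilde\sigma_1>\widetilde\sigma_2>\cdots>\widetilde\sigma_s$, $1\le s\le r$, be the distinct singular values of $\Sigma_1$. Fix any $\lambda\in(\widetilde\sigma_{k+1},\widetilde\sigma_k)$ for some $0\le k\le s$, where $\widetilde\sigma_0=+\infty$ and $\widetilde\sigma_{s+1}=0$. Consider any $(\overline U,\overline V)\in\overline{\mathcal{W}}_\lambda$, i.e. any global minimizer of $\widetilde\Phi_\lambda$. Then there exists a constant $\eta>0$ such that for all $(U,V)\in\mathbb{B}((\overline U,\overline V),\delta)$ with $$\delta\le\min\Big\{\frac{\sqrt{\widetilde\sigma_k-\lambda}}{2},\ \frac{\lambda-\widetilde\sigma_{k+1}}{2\sqrt{\widetilde\sigma_1}},\ \frac{\widetilde\sigma_s-\sigma_{r+1}(\Sigma)}{4\sqrt{\widetilde\sigma_1}}\Big\},$$ one has $$\|\nabla\widetilde\Phi_\lambda(U,V)\|_F^2\ge\eta\big[\widetilde\Phi_\lambda(U,V)-\widetilde\Phi_\lambda(\overline U,\overline V)\big].$$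
   Context: Let $n\le m$, and let $M=M^*+E\in\mathbb{R}^{n\times m}$ be a noisy observation of a true matrix $M^*$ of rank $r^*\ge1$ with $4r^*\le\min(m,n)$, where $E\in\mathbb{R}^{n\times m}$ is a noise matrix. Set $r=r^*$. Let $\sigma(M)$ be the vector of singular values of $M$ in nonincreasing order, $\Sigma:=\mathrm{Diag}(\sigma(M))\in\mathbb{R}^{n\times m}$ (rectangular diagonal), so $\sigma_i(\Sigma)=\sigma_i(M)$, and $\Sigma_1:=\mathrm{Diag}(\sigma_1(M),\dots,\sigma_r(M))\in\mathbb{R}^{r\times r}$. For $\lambda>0$ define $$\widetilde\Phi_\lambda(U,V):=\tfrac12\|UV^{\mathbb{T}}-\Sigma\|_F^2+\tfrac{\lambda}{2}\big(\|U\|_F^2+\|V\|_F^2\big),\qquad (U,V)\in\mathbb{R}^{n\times r}\times\mathbb{R}^{m\times r},$$ and let $\overline{\mathcal{W}}_\lambda$ be the set of global minimizers of $\widetilde\Phi_\lambda$. $\|\cdot\|_F$ is the Frobenius norm, with $\|(A,B)\|_F^2=\|A\|_F^2+\|B\|_F^2$ on pairs, and $\mathbb{B}((\overline U,\overline V),\delta)$ is the closed Frobenius-norm ball of radius $\delta$ centered at $(\overline U,\overline V)$. *)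

theory Defs
  imports
    "HOL-Analysis.Analysis"
    "HOL-Computational_Algebra.Polynomial"
    "HOL-Library.Multiset"
    "HOL-Library.More_List"
    "HOL-Library.Extended_Real"
begin

text \<open>
  An $n \times m$ real matrix is an element of \<^typ>\<open>real^'m^'n\<close>, with
  \<^term>\<open>CARD('n)\<close> rows. The library norm on this type (Euclidean norm of the vector of
  Euclidean row norms) is the Frobenius norm, and the norm on the product type of pairs
  \<open>(U, V)\<close> is \<open>sqrt ((norm U)\<^sup>2 + (norm V)\<^sup>2)\<close>; so \<^const>\<open>cball\<close>,
  \<^const>\<open>inner\<close> and the gradient on pairs are the Frobenius ones.
  The index types are linearly ordered only to make sense of the diagonal of a rectangular
  matrix.
\<close>

definition charpoly :: "real^'n^'n \<Rightarrow> real poly" where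
  "charpoly A = det (\<chi> i j. if i = j then [: - (A $ i $ j), 1 :] else [: - (A $ i $ j) :])"

text \<open>
  The singular values of \<open>A\<close> are the square roots of the eigenvalues of \<open>A A\<^sup>T\<close>, counted with
  algebraic multiplicity and listed in nonincreasing order.
\<close>

definition singular_values :: "real^'m^'n \<Rightarrow> real list" where
  "singular_values A =
     rev (sorted_list_of_multiset (image_mset sqrt (proots (charpoly (A ** transpose A)))))"

text \<open>
  \<open>singular_value A i\<close> is $\sigma_i(A)$, with \<open>i\<close> counted from \<open>1\<close>; it is \<open>0\<close> when \<open>i\<close> exceeds
  the length of the list. The value at index \<open>0\<close> is meaningless.
\<close>

definition singular_value :: "real^'m^'n \<Rightarrow> nat \<Rightarrow> real" where
  "singular_value A i = nth_default 0 (singular_values A) (i - 1)"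

text \<open>The position of an index in the order of its type, counted from \<open>1\<close>.\<close>

definition position :: "'a::{finite,linorder} \<Rightarrow> nat" where
  "position i = card {..i}"

definition rect_diag :: "(nat \<Rightarrow> real) \<Rightarrow> real^('m::{finite,linorder})^('n::{finite,linorder})"
  where "rect_diag d = (\<chi> i j. if position i = position j then d (position i) else 0)"

definition Phi ::
  "real^'m^'n \<Rightarrow> real \<Rightarrow> (real^'r^'n) \<times> (real^'r^'m) \<Rightarrow> real" where
  "Phi S lam = (\<lambda>(U, V). 1 / 2 * (norm (U ** transpose V - S))\<^sup>2
                       + lam / 2 * ((norm U)\<^sup>2 + (norm V)\<^sup>2))"

definition global_minimizers :: "('a \<Rightarrow> real) \<Rightarrow> 'a set" where
  "global_minimizers f = {x. \<forall>y. f x \<le> f y}"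

definition gradient :: "('a::real_inner \<Rightarrow> real) \<Rightarrow> 'a \<Rightarrow> 'a" where
  "gradient f x = (THE D. GDERIV f x :> D)"

end

(*
Writing u_i and v_j for the rows of U and V, the objective only involves the inner products u_i . v_j
and the norms of the rows. At a critical point the rows of U and V agree, u_i = v_i, rows beyond the
diagonal vanish, and each u_i is an eigenvector of G = sum_i u_i u_i^T with eigenvalue sigma_i - lambda.
Let T be the set of indices i <= r with sigma_i > lambda. If the rows u_i, i in T, are linearly
independent, the eigenvector equation makes them orthogonal with |u_i|^2 = sigma_i - lambda and kills
all other rows: these are the "optimal" points. A global minimizer is optimal, since otherwise a linear
relation among the rows in T gives a direction of negative curvature; and a critical point at distance
less than sqrt (sigma_i - lambda), i in T, from an optimal point has independent rows in T.

Let x be the optimal point closest to z. Comparing x with its rotations by the orthogonal group acting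
on the right shows that h = z - x is orthogonal to the orbit of x, and on such h the Hessian at x is
bounded below by a constant that does not depend on x. A Taylor expansion gives the inequality in a tube
around the optimal set. The part of the ball outside the tube is compact and contains no critical point.
*)
theory Submission
  imports Defs
begin

section \<open>The objective in terms of matrix rows\<close>

text \<open>
  \<open>\<pi> i\<close> is the column carrying the diagonal entry \<open>\<sigma> i\<close> of row \<open>i\<close>, so that no order on the index
  types is needed; \<open>T\<close> collects the rows that survive the soft-thresholding at \<open>lam\<close>.
\<close>

locale factorization =
  fixes \<pi> :: "'n::finite \<Rightarrow> 'm::finite" and \<sigma> :: "'n \<Rightarrow> real" and lam :: real
    and T :: "'n set" and rt :: "'r::finite itself"
  assumes inj_\<pi>: "inj \<pi>"
    and \<sigma>_nonneg: "0 \<le> \<sigma> i"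
    and lam_pos: "0 < lam"
    and T_gt: "i \<in> T \<Longrightarrow> lam < \<sigma> i"
    and T_gap: "i \<in> T \<Longrightarrow> j \<notin> T \<Longrightarrow> \<sigma> j < \<sigma> i"
    and card_T: "card T \<le> CARD('r)"
    and outside: "(\<forall>j. j \<notin> T \<longrightarrow> \<sigma> j < lam) \<or> card T = CARD('r)"
begin

definition target :: "'n \<Rightarrow> 'm \<Rightarrow> real" where
  "target i j = (if j = \<pi> i then \<sigma> i else 0)"

definition res :: "(real^'r^'n) \<times> (real^'r^'m) \<Rightarrow> 'n \<Rightarrow> 'm \<Rightarrow> real" where
  "res x i j = fst x $ i \<bullet> snd x $ j - target i j"

text \<open>The derivative of the product U V^T at \<open>x\<close> along \<open>h\<close>. With the
  quadratic part \<open>cross h\<close> it makes the expansion of \<open>res\<close> in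
  \<open>res_add\<close> exact.\<close>

definition lin :: "(real^'r^'n) \<times> (real^'r^'m) \<Rightarrow> (real^'r^'n) \<times> (real^'r^'m) \<Rightarrow> 'n \<Rightarrow> 'm \<Rightarrow> real" where
  "lin x h i j = fst h $ i \<bullet> snd x $ j + fst x $ i \<bullet> snd h $ j"

definition cross :: "(real^'r^'n) \<times> (real^'r^'m) \<Rightarrow> 'n \<Rightarrow> 'm \<Rightarrow> real" where
  "cross h i j = fst h $ i \<bullet> snd h $ j"

definition f :: "(real^'r^'n) \<times> (real^'r^'m) \<Rightarrow> real" where
  "f x = 1 / 2 * (\<Sum>i\<in>UNIV. \<Sum>j\<in>UNIV. (res x i j)\<^sup>2) + lam / 2 * (x \<bullet> x)"

definition grad :: "(real^'r^'n) \<times> (real^'r^'m) \<Rightarrow> (real^'r^'n) \<times> (real^'r^'m)" where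
  "grad x = ((\<chi> i. (\<Sum>j\<in>UNIV. res x i j *\<^sub>R snd x $ j) + lam *\<^sub>R fst x $ i),
             (\<chi> j. (\<Sum>i\<in>UNIV. res x i j *\<^sub>R fst x $ i) + lam *\<^sub>R snd x $ j))"

text \<open>The full second derivative of \<open>f\<close> as a quadratic form, so it carries the
  factor 1/2 in the Taylor formula.\<close>

definition hess :: "(real^'r^'n) \<times> (real^'r^'m) \<Rightarrow> (real^'r^'n) \<times> (real^'r^'m) \<Rightarrow> real" where
  "hess x h = (\<Sum>i\<in>UNIV. \<Sum>j\<in>UNIV. (lin x h i j)\<^sup>2 + 2 * res x i j * cross h i j) + lam * (h \<bullet> h)"

section \<open>Exact Taylor expansion and derivative of the objective\<close>

lemma inner_pair_rows:
  fixes x h :: "(real^'r^'n) \<times> (real^'r^'m)"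
  shows "x \<bullet> h = (\<Sum>i\<in>UNIV. fst x $ i \<bullet> fst h $ i) + (\<Sum>j\<in>UNIV. snd x $ j \<bullet> snd h $ j)"
  by (simp add: inner_prod_def inner_vec_def)

lemma res_add: "res (x + h) i j = res x i j + lin x h i j + cross h i j"
  by (simp add: res_def lin_def cross_def inner_add_left inner_add_right)

lemma lin_add: "lin (x + h) h i j = lin x h i j + 2 * cross h i j"
  by (simp add: lin_def cross_def inner_add_left inner_add_right)

text \<open>Chain rule: \<open>lin x h\<close> is the directional derivative of \<open>res\<close>.
  In this paired form \<open>grad\<close> enters the expansions and is recognized as the
  derivative.\<close>

lemma inner_grad:
  "grad x \<bullet> h = (\<Sum>i\<in>UNIV. \<Sum>j\<in>UNIV. res x i j * lin x h i j) + lam * (x \<bullet> h)"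
proof -
  have "grad x \<bullet> h =
      (\<Sum>i\<in>UNIV. (\<Sum>j\<in>UNIV. res x i j * (snd x $ j \<bullet> fst h $ i)) + lam * (fst x $ i \<bullet> fst h $ i))
    + (\<Sum>j\<in>UNIV. (\<Sum>i\<in>UNIV. res x i j * (fst x $ i \<bullet> snd h $ j)) + lam * (snd x $ j \<bullet> snd h $ j))"
    by (simp add: grad_def inner_pair_rows inner_add_left inner_sum_left)
  also have "\<dots> = (\<Sum>i\<in>UNIV. \<Sum>j\<in>UNIV. res x i j * (snd x $ j \<bullet> fst h $ i))
      + (\<Sum>j\<in>UNIV. \<Sum>i\<in>UNIV. res x i j * (fst x $ i \<bullet> snd h $ j)) + lam * (x \<bullet> h)"
    by (simp add: inner_pair_rows sum.distrib sum_distrib_left[symmetric] algebra_simps)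
  also have "(\<Sum>j\<in>UNIV. \<Sum>i\<in>UNIV. res x i j * (fst x $ i \<bullet> snd h $ j))
      = (\<Sum>i\<in>UNIV. \<Sum>j\<in>UNIV. res x i j * (fst x $ i \<bullet> snd h $ j))"
    by (rule sum.swap)
  finally show ?thesis
    by (simp add: lin_def sum.distrib inner_commute algebra_simps)
qed

text \<open>An identity rather than an estimate: each entry of U V^T is quadratic in the point, so
  \<open>f\<close> is a polynomial of degree four.\<close>

lemma f_expand:
  "f (x + h) = f x + grad x \<bullet> h + hess x h / 2
     + (\<Sum>i\<in>UNIV. \<Sum>j\<in>UNIV. lin x h i j * cross h i j)
     + 1 / 2 * (\<Sum>i\<in>UNIV. \<Sum>j\<in>UNIV. (cross h i j)\<^sup>2)"
proof -
  have sq: "(res (x + h) i j)\<^sup>2 = (res x i j)\<^sup>2 + 2 * (res x i j * lin x h i j)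
      + ((lin x h i j)\<^sup>2 + 2 * res x i j * cross h i j) + 2 * (lin x h i j * cross h i j)
      + (cross h i j)\<^sup>2" for i j
    unfolding res_add by (simp add: power2_eq_square algebra_simps)
  have nn: "(x + h) \<bullet> (x + h) = x \<bullet> x + 2 * (x \<bullet> h) + h \<bullet> h"
    by (simp add: inner_add_left inner_add_right inner_commute)
  show ?thesis
    unfolding f_def sq nn inner_grad hess_def sum.distrib sum_distrib_left[symmetric]
    by (simp add: field_simps)
qed

text \<open>Only the component along \<open>h\<close> is needed. It is the derivative of f (x + t h)
  in t at t = 1, so the terms of degree 1, 2, 3, 4 of \<open>f_expand\<close> reappear multiplied by
  their degrees.\<close>

lemma grad_expand:
  "grad (x + h) \<bullet> h = grad x \<bullet> h + hess x h
     + 3 * (\<Sum>i\<in>UNIV. \<Sum>j\<in>UNIV. lin x h i j * cross h i j)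
     + 2 * (\<Sum>i\<in>UNIV. \<Sum>j\<in>UNIV. (cross h i j)\<^sup>2)"
proof -
  have sq: "res (x + h) i j * lin (x + h) h i j = res x i j * lin x h i j
      + ((lin x h i j)\<^sup>2 + 2 * res x i j * cross h i j) + 3 * (lin x h i j * cross h i j)
      + 2 * (cross h i j)\<^sup>2" for i j
    unfolding res_add lin_add by (simp add: power2_eq_square algebra_simps)
  show ?thesis
    unfolding inner_grad sq hess_def sum.distrib sum_distrib_left[symmetric] inner_add_left
    by (simp add: algebra_simps)
qed

lemma has_derivative_rows [derivative_intros]:
  fixes g :: "'a::real_normed_vector \<Rightarrow> (real^'r^'n) \<times> (real^'r^'m)"
  assumes "(g has_derivative g') F"
  shows "((\<lambda>x. fst (g x) $ i) has_derivative (\<lambda>h. fst (g' h) $ i)) F"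
    and "((\<lambda>x. snd (g x) $ j) has_derivative (\<lambda>h. snd (g' h) $ j)) F"
  by (rule bounded_linear.has_derivative[OF bounded_linear_vec_nth]
      has_derivative_fst has_derivative_snd assms)+

lemma has_derivative_f: "(f has_derivative (\<lambda>h. h \<bullet> grad x)) (at x)"
proof -
  have "(f has_derivative (\<lambda>h. (\<Sum>i\<in>UNIV. \<Sum>j\<in>UNIV. res x i j * lin x h i j) + lam * (x \<bullet> h))) (at x)"
    unfolding f_def[abs_def] res_def
    by (rule derivative_eq_intros refl | simp)+
      (auto simp: fun_eq_iff lin_def sum_distrib_left inner_commute algebra_simps intro!: sum.cong)
  then show ?thesis
    by (simp only: inner_grad[symmetric] inner_commute[of _ "grad x"])
qed

text \<open>\<open>gradient\<close> is a definite description, so uniqueness of the derivative is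
  required as well.\<close>

lemma gradient_f: "gradient f x = grad x"
  unfolding gradient_def gderiv_def
proof (rule the_equality)
  show "(f has_derivative (\<lambda>h. h \<bullet> grad x)) (at x)" by (rule has_derivative_f)
next
  fix D assume "(f has_derivative (\<lambda>h. h \<bullet> D)) (at x)"
  then have "(\<lambda>h. h \<bullet> D) = (\<lambda>h. h \<bullet> grad x)"
    by (rule has_derivative_unique[OF _ has_derivative_f])
  then show "D = grad x"
    by (metis vector_eq_ldot)
qed

lemma continuous_f: "continuous_on A f"
  by (meson continuous_at_imp_continuous_on has_derivative_continuous has_derivative_f)

lemma continuous_grad: "continuous_on A grad"
  unfolding grad_def[abs_def] res_def by (intro continuous_intros)

lemma grad_minimizer:
  assumes "x \<in> global_minimizers f" shows "grad x = 0"
proof -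
  have "(\<lambda>h. h \<bullet> grad x) = (\<lambda>h. 0)"
    by (rule differential_zero_maxmin[of x UNIV, OF _ _ has_derivative_f])
      (use assms in \<open>auto simp: global_minimizers_def\<close>)
  then show ?thesis
    by (metis inner_eq_zero_iff)
qed

lemma lin_scaleR: "lin x (t *\<^sub>R h) i j = t * lin x h i j"
  and cross_scaleR: "cross (t *\<^sub>R h) i j = t\<^sup>2 * cross h i j"
  by (simp_all add: lin_def cross_def algebra_simps power2_eq_square)

text \<open>Second-order necessary condition: the linear term vanishes, so f (x + t h) - f x is t^2
  times a polynomial in t, whose value at 0 is the limit of nonnegative numbers.\<close>

lemma hess_minimizer:
  assumes "x \<in> global_minimizers f" shows "0 \<le> hess x h"
proof -
  define b where "b = (\<Sum>i\<in>UNIV. \<Sum>j\<in>UNIV. lin x h i j * cross h i j)"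
  define c where "c = 1 / 2 * (\<Sum>i\<in>UNIV. \<Sum>j\<in>UNIV. (cross h i j)\<^sup>2)"
  have "0 \<le> hess x h / 2 + b * t + c * t\<^sup>2" if "t > 0" for t :: real
  proof -
    have "f x \<le> f (x + t *\<^sub>R h)" using assms unfolding global_minimizers_def by blast
    also have "\<dots> = f x + t\<^sup>2 * (hess x h / 2 + b * t + c * t\<^sup>2)"
      unfolding f_expand grad_minimizer[OF assms] b_def c_def hess_def lin_scaleR cross_scaleR
      by (simp add: power_mult_distrib algebra_simps sum_distrib_left sum.distrib power2_eq_square)
    finally show ?thesis using that
      by (simp add: zero_le_mult_iff)
  qed
  then have "eventually (\<lambda>t. 0 \<le> hess x h / 2 + b * t + c * t\<^sup>2) (at_right 0)"
    by (auto simp: eventually_at_right_field intro: exI[of _ 1])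
  moreover have "((\<lambda>t. hess x h / 2 + b * t + c * t\<^sup>2) \<longlongrightarrow> hess x h / 2 + b * 0 + c * 0\<^sup>2) (at_right 0)"
    by (intro tendsto_intros)
  ultimately have "0 \<le> hess x h / 2 + b * 0 + c * 0\<^sup>2"
    by (intro tendsto_lowerbound) auto
  then show ?thesis by simp
qed

section \<open>Critical points\<close>

lemma target_range:
  fixes u :: "'n \<Rightarrow> real^'r"
  shows "(\<Sum>i\<in>UNIV. target i (\<pi> l) *\<^sub>R u i) = \<sigma> l *\<^sub>R u l"
proof -
  have "target i (\<pi> l) *\<^sub>R u i = (if i = l then \<sigma> l *\<^sub>R u l else 0)" for i
    using inj_\<pi> by (auto simp: target_def inj_def)
  then show ?thesis by simp
qed

lemma target_off_range:
  fixes u :: "'n \<Rightarrow> real^'r"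
  shows "j \<notin> range \<pi> \<Longrightarrow> (\<Sum>i\<in>UNIV. target i j *\<^sub>R u i) = 0"
  by (intro sum.neutral) (auto simp: target_def)

text \<open>The operator on the left is U^T U for the matrix U with rows \<open>u l\<close>; it is
  positive semidefinite.\<close>

lemma psd_negative_eigenvector:
  fixes u :: "'n \<Rightarrow> real^'r"
  assumes "(\<Sum>l\<in>UNIV. (d \<bullet> u l) *\<^sub>R u l) = t *\<^sub>R d" "t < 0"
  shows "d = 0"
proof -
  have "t * (d \<bullet> d) = d \<bullet> (\<Sum>l\<in>UNIV. (d \<bullet> u l) *\<^sub>R u l)"
    using assms by simp
  also have "\<dots> = (\<Sum>l\<in>UNIV. (d \<bullet> u l)\<^sup>2)"
    by (simp add: inner_sum_right power2_eq_square)
  finally have "0 \<le> t * (d \<bullet> d)"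
    by (simp add: sum_nonneg)
  then have "d \<bullet> d \<le> 0"
    using assms(2) by (simp add: zero_le_mult_iff)
  then show ?thesis
    by (metis inner_eq_zero_iff inner_ge_zero order.antisym)
qed

context
  fixes x :: "(real^'r^'n) \<times> (real^'r^'m)"
  assumes critical: "grad x = 0"
begin

text \<open>The rows of U V^T V + lam U = S V and V U^T U + lam V = S^T U, where S has the entries
  \<open>target\<close>.\<close>

lemma critical_eqs:
  shows "(\<Sum>j\<in>UNIV. (fst x $ i \<bullet> snd x $ j) *\<^sub>R snd x $ j) + lam *\<^sub>R fst x $ i = \<sigma> i *\<^sub>R snd x $ \<pi> i"
    and "(\<Sum>i\<in>UNIV. (fst x $ i \<bullet> snd x $ j) *\<^sub>R fst x $ i) + lam *\<^sub>R snd x $ j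
       = (\<Sum>i\<in>UNIV. target i j *\<^sub>R fst x $ i)"
proof -
  have "fst (grad x) $ i = 0" "snd (grad x) $ j = 0"
    using critical by simp_all
  then have "(\<Sum>j\<in>UNIV. (fst x $ i \<bullet> snd x $ j) *\<^sub>R snd x $ j) + lam *\<^sub>R fst x $ i
        = (\<Sum>j\<in>UNIV. target i j *\<^sub>R snd x $ j)"
    and 2: "(\<Sum>i\<in>UNIV. (fst x $ i \<bullet> snd x $ j) *\<^sub>R fst x $ i) + lam *\<^sub>R snd x $ j
       = (\<Sum>i\<in>UNIV. target i j *\<^sub>R fst x $ i)"
    by (simp_all add: grad_def res_def scaleR_diff_left sum_subtractf algebra_simps)
  moreover have "(\<Sum>j\<in>UNIV. target i j *\<^sub>R snd x $ j) = \<sigma> i *\<^sub>R snd x $ \<pi> i"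
    by (simp add: target_def if_distrib[where f="\<lambda>t. t *\<^sub>R _"] cong: if_cong)
  ultimately show "(\<Sum>j\<in>UNIV. (fst x $ i \<bullet> snd x $ j) *\<^sub>R snd x $ j) + lam *\<^sub>R fst x $ i
        = \<sigma> i *\<^sub>R snd x $ \<pi> i" by simp
  show "(\<Sum>i\<in>UNIV. (fst x $ i \<bullet> snd x $ j) *\<^sub>R fst x $ i) + lam *\<^sub>R snd x $ j
       = (\<Sum>i\<in>UNIV. target i j *\<^sub>R fst x $ i)" by (fact 2)
qed

text \<open>This is U^T U = V^T V as bilinear forms. Pairing the first critical equation with the
  rows of U and the second with those of V produces the same quartic term \<open>c\<close> and the
  same right-hand side, so the terms multiplied by \<open>lam\<close> agree.\<close>

lemma critical_balanced:
  "(\<Sum>i\<in>UNIV. (y \<bullet> fst x $ i) * (z \<bullet> fst x $ i)) = (\<Sum>j\<in>UNIV. (y \<bullet> snd x $ j) * (z \<bullet> snd x $ j))"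
proof -
  define c where "c = (\<Sum>i\<in>UNIV. \<Sum>j\<in>UNIV. (fst x $ i \<bullet> snd x $ j) * (y \<bullet> snd x $ j) * (z \<bullet> fst x $ i))"
  have "lam * (\<Sum>i\<in>UNIV. (y \<bullet> fst x $ i) * (z \<bullet> fst x $ i)) + c =
     (\<Sum>i\<in>UNIV. (y \<bullet> ((\<Sum>j\<in>UNIV. (fst x $ i \<bullet> snd x $ j) *\<^sub>R snd x $ j) + lam *\<^sub>R fst x $ i)) * (z \<bullet> fst x $ i))"
    unfolding c_def inner_add_right inner_sum_right
    by (simp add: sum.distrib sum_distrib_left sum_distrib_right algebra_simps)
  also have "\<dots> = (\<Sum>i\<in>UNIV. \<sigma> i * (y \<bullet> snd x $ \<pi> i) * (z \<bullet> fst x $ i))"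
    unfolding critical_eqs by simp
  finally have 1: "lam * (\<Sum>i\<in>UNIV. (y \<bullet> fst x $ i) * (z \<bullet> fst x $ i)) + c = \<dots>" .
  have c2: "c = (\<Sum>j\<in>UNIV. \<Sum>i\<in>UNIV. (fst x $ i \<bullet> snd x $ j) * (y \<bullet> snd x $ j) * (z \<bullet> fst x $ i))"
    unfolding c_def by (rule sum.swap)
  have "lam * (\<Sum>j\<in>UNIV. (y \<bullet> snd x $ j) * (z \<bullet> snd x $ j)) + c =
     (\<Sum>j\<in>UNIV. (y \<bullet> snd x $ j) * (z \<bullet> ((\<Sum>i\<in>UNIV. (fst x $ i \<bullet> snd x $ j) *\<^sub>R fst x $ i) + lam *\<^sub>R snd x $ j)))"
    unfolding c2 inner_add_right inner_sum_right
    by (simp add: sum.distrib sum_distrib_left sum_distrib_right algebra_simps)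
  also have "\<dots> = (\<Sum>j\<in>UNIV. \<Sum>i\<in>UNIV. target i j * ((y \<bullet> snd x $ j) * (z \<bullet> fst x $ i)))"
    unfolding critical_eqs by (simp add: inner_sum_right sum_distrib_left mult_ac)
  also have "\<dots> = (\<Sum>i\<in>UNIV. \<Sum>j\<in>UNIV. target i j * ((y \<bullet> snd x $ j) * (z \<bullet> fst x $ i)))"
    by (rule sum.swap)
  also have "\<dots> = (\<Sum>i\<in>UNIV. \<sigma> i * (y \<bullet> snd x $ \<pi> i) * (z \<bullet> fst x $ i))"
    by (simp add: target_def if_distrib[where f="\<lambda>t. t * _"] mult.assoc cong: if_cong)
  finally have "lam * (\<Sum>i\<in>UNIV. (y \<bullet> fst x $ i) * (z \<bullet> fst x $ i))
      = lam * (\<Sum>j\<in>UNIV. (y \<bullet> snd x $ j) * (z \<bullet> snd x $ j))"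
    using 1 by linarith
  then show ?thesis using lam_pos by simp
qed

lemma balanced_operator:
  "(\<Sum>j\<in>UNIV. (y \<bullet> snd x $ j) *\<^sub>R snd x $ j) = (\<Sum>i\<in>UNIV. (y \<bullet> fst x $ i) *\<^sub>R fst x $ i)"
  by (rule vector_eq_ldot[THEN iffD1])
    (simp add: inner_sum_right critical_balanced)

text \<open>Let G = U^T U = V^T V. The critical equations read G u = \<sigma> v - lam u and G v =
  \<sigma> u - lam v. Subtracting them shows G (v - u) = (- lam - \<sigma>) (v - u), and G has no
  negative eigenvalue.\<close>

lemma critical_snd: "snd x $ \<pi> i = fst x $ i"
proof -
  let ?u = "fst x $ i" and ?v = "snd x $ \<pi> i"
  have 1: "(\<Sum>l\<in>UNIV. (?u \<bullet> fst x $ l) *\<^sub>R fst x $ l) = \<sigma> i *\<^sub>R ?v - lam *\<^sub>R ?u"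
    using critical_eqs(1)[of i] by (simp add: balanced_operator eq_diff_eq)
  have 2: "(\<Sum>l\<in>UNIV. (?v \<bullet> fst x $ l) *\<^sub>R fst x $ l) = \<sigma> i *\<^sub>R ?u - lam *\<^sub>R ?v"
    using critical_eqs(2)[of "\<pi> i"] by (simp add: target_range inner_commute eq_diff_eq)
  have "?v - ?u = 0"
  proof (rule psd_negative_eigenvector)
    show "(\<Sum>l\<in>UNIV. ((?v - ?u) \<bullet> fst x $ l) *\<^sub>R fst x $ l) = (- lam - \<sigma> i) *\<^sub>R (?v - ?u)"
      unfolding inner_diff_left scaleR_diff_left sum_subtractf 1 2 by (simp add: algebra_simps)
    show "- lam - \<sigma> i < 0" using lam_pos \<sigma>_nonneg[of i] by linarith
  qed
  then show ?thesis by simp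
qed

text \<open>Column \<open>j\<close> of the target is zero, so the second critical equation becomes G
  v = - lam v.\<close>

lemma critical_snd_off_range: "j \<notin> range \<pi> \<Longrightarrow> snd x $ j = 0"
  using critical_eqs(2)[of j] lam_pos
  by (intro psd_negative_eigenvector[where t="- lam" and u="\<lambda>l. fst x $ l"])
    (simp_all add: target_off_range inner_commute eq_neg_iff_add_eq_0)

lemma critical_eigen:
  "(\<Sum>l\<in>UNIV. (fst x $ i \<bullet> fst x $ l) *\<^sub>R fst x $ l) = (\<sigma> i - lam) *\<^sub>R fst x $ i"
  using critical_eqs(1)[of i]
  by (simp add: balanced_operator critical_snd algebra_simps)

lemma critical_orthogonal:
  assumes "\<sigma> i \<noteq> \<sigma> j" shows "fst x $ i \<bullet> fst x $ j = 0"
proof -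
  have "(\<sigma> i - lam) * (fst x $ i \<bullet> fst x $ j) = (\<sigma> j - lam) * (fst x $ i \<bullet> fst x $ j)"
    using arg_cong[OF critical_eigen[of i], of "\<lambda>y. y \<bullet> fst x $ j"]
      arg_cong[OF critical_eigen[of j], of "\<lambda>y. fst x $ i \<bullet> y"]
    by (simp add: inner_sum_left inner_sum_right inner_commute mult.commute)
  then show ?thesis using assms by simp
qed

lemma critical_small: "\<sigma> j < lam \<Longrightarrow> fst x $ j = 0"
  by (rule psd_negative_eigenvector[OF critical_eigen]) simp

lemma critical_outside:
  assumes "i \<in> T" "j \<notin> T" shows "fst x $ i \<bullet> fst x $ j = 0"
  using T_gap[OF assms] by (intro critical_orthogonal) simp

end

text \<open>Phrased with coefficients indexed by \<open>T\<close>: independence of the set of rows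
  would not notice repeated rows.\<close>

definition rows_independent :: "(real^'r^'n) \<times> (real^'r^'m) \<Rightarrow> bool" where
  "rows_independent x \<longleftrightarrow> (\<forall>c. (\<Sum>i\<in>T. c i *\<^sub>R fst x $ i) = 0 \<longrightarrow> (\<forall>i\<in>T. c i = 0))"

text \<open>The balanced factorizations of the soft-thresholded target, which keeps the entries
  \<open>\<sigma> i - lam\<close> for \<open>i\<close> in \<open>T\<close>; they differ only in the
  choice of the orthogonal frame of rows.\<close>

definition optimal :: "((real^'r^'n) \<times> (real^'r^'m)) set" where
  "optimal = {x. (\<forall>i. snd x $ \<pi> i = fst x $ i) \<and> (\<forall>j. j \<notin> range \<pi> \<longrightarrow> snd x $ j = 0) \<and>
     (\<forall>i. i \<notin> T \<longrightarrow> fst x $ i = 0) \<and>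
     (\<forall>i\<in>T. \<forall>j\<in>T. fst x $ i \<bullet> fst x $ j = (if i = j then \<sigma> i - lam else 0))}"

text \<open>Dimension count: together with a nonzero \<open>z\<close> the rows would form more than
  CARD('r) independent vectors.\<close>

lemma orthogonal_to_full_frame:
  fixes u :: "'n \<Rightarrow> real^'r"
  assumes card: "card T = CARD('r)" and orth: "\<And>i j. i \<in> T \<Longrightarrow> j \<in> T \<Longrightarrow> i \<noteq> j \<Longrightarrow> u i \<bullet> u j = 0"
    and nz: "\<And>i. i \<in> T \<Longrightarrow> u i \<noteq> 0" and z: "\<And>i. i \<in> T \<Longrightarrow> u i \<bullet> z = 0"
  shows "z = 0"
proof (rule ccontr)
  assume "z \<noteq> 0"
  have inj: "inj_on u T"
    using orth nz by (metis inj_onI inner_eq_zero_iff)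
  have "z \<notin> u ` T" using z \<open>z \<noteq> 0\<close> by (metis imageE inner_eq_zero_iff)
  have "pairwise orthogonal (insert z (u ` T))"
    using orth z by (auto simp: pairwise_def orthogonal_def inner_commute)
  then have "independent (insert z (u ` T))"
    using \<open>z \<noteq> 0\<close> nz by (intro pairwise_orthogonal_independent) auto
  then have "card (insert z (u ` T)) \<le> CARD('r)"
    using independent_bound[of "insert z (u ` T)"] by simp
  then show False
    using \<open>z \<notin> u ` T\<close> card by (simp add: card_image[OF inj])
qed

text \<open>For a row in \<open>T\<close> the eigenvector equation involves rows in \<open>T\<close>
  only, because \<open>T_gap\<close> makes the others orthogonal to it. It is then a linear relation
  between independent rows and determines all inner products. By \<open>outside\<close>, a row not
  in \<open>T\<close> either has a negative eigenvalue or is orthogonal to a frame filling the whole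
  space.\<close>

lemma critical_independent_optimal:
  assumes crit: "grad x = 0" and indep: "rows_independent x"
  shows "x \<in> optimal"
proof -
  have orth: "fst x $ i \<bullet> fst x $ j = (if i = j then \<sigma> i - lam else 0)" if "i \<in> T" "j \<in> T" for i j
  proof -
    have "(\<sigma> i - lam) *\<^sub>R fst x $ i = (\<Sum>l\<in>T. (fst x $ i \<bullet> fst x $ l) *\<^sub>R fst x $ l)"
      unfolding critical_eigen[OF crit, of i, symmetric]
      by (rule sum.mono_neutral_right) (auto simp: critical_outside[OF crit \<open>i \<in> T\<close>])
    then have "(\<Sum>l\<in>T. ((fst x $ i \<bullet> fst x $ l) - (if i = l then \<sigma> i - lam else 0)) *\<^sub>R fst x $ l) = 0"
      using \<open>i \<in> T\<close>
      by (simp add: scaleR_diff_left sum_subtractf if_distrib[where f="\<lambda>t. t *\<^sub>R _"] cong: if_cong)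
    then have "(fst x $ i \<bullet> fst x $ j) - (if i = j then \<sigma> i - lam else 0) = 0"
      using indep[unfolded rows_independent_def, rule_format,
          of "\<lambda>l. (fst x $ i \<bullet> fst x $ l) - (if i = l then \<sigma> i - lam else 0)"] \<open>j \<in> T\<close> by simp
    then show ?thesis by simp
  qed
  have "fst x $ j = 0" if "j \<notin> T" for j
    using outside
  proof
    assume "\<forall>j. j \<notin> T \<longrightarrow> \<sigma> j < lam"
    then show ?thesis using that critical_small[OF crit] by blast
  next
    assume card: "card T = CARD('r)"
    show ?thesis
    proof (rule orthogonal_to_full_frame[OF card])
      show "fst x $ i \<noteq> 0" if "i \<in> T" for i
        using orth[OF that that] T_gt[OF that] by auto
    qed (use orth that critical_outside[OF crit] in auto)
  qed
  then show ?thesis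
    using orth critical_snd[OF crit] critical_snd_off_range[OF crit] by (simp add: optimal_def)
qed

section \<open>Global minimizers are optimal\<close>

lemma sum_over_range:
  assumes "\<And>j. j \<notin> range \<pi> \<Longrightarrow> F j = 0"
  shows "(\<Sum>j\<in>UNIV. F j) = (\<Sum>i\<in>UNIV. F (\<pi> i) :: real)"
proof -
  have "(\<Sum>j\<in>UNIV. F j) = (\<Sum>j\<in>range \<pi>. F j)"
    using assms by (intro sum.mono_neutral_right) auto
  then show ?thesis by (simp add: sum.reindex[OF inj_\<pi>])
qed

text \<open>The rows other than \<open>i\<close> span fewer than CARD('r) dimensions; a vector
  orthogonal to them is orthogonal to row \<open>i\<close> too, by the relation.\<close>

lemma dependent_orthogonal_vector:
  fixes u :: "'n \<Rightarrow> real^'r"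
  assumes "i \<in> T" "c i \<noteq> 0" "(\<Sum>i\<in>T. c i *\<^sub>R u i) = 0"
  obtains z where "z \<noteq> 0" "\<And>i. i \<in> T \<Longrightarrow> z \<bullet> u i = 0"
proof -
  let ?S = "u ` (T - {i})"
  have "finite ?S" by simp
  then have "dim ?S \<le> card ?S"
    by (simp add: dim_le_card')
  also have "\<dots> \<le> card (T - {i})" by (simp add: card_image_le)
  also have "\<dots> < card T" using \<open>i \<in> T\<close> by (intro card_Diff1_less) auto
  finally have "dim ?S < DIM(real^'r)" using card_T by simp
  then obtain z where z: "z \<noteq> 0" "\<And>y. y \<in> span ?S \<Longrightarrow> orthogonal z y"
    using orthogonal_to_subspace_exists by blast
  have 0: "z \<bullet> u l = 0" if "l \<in> T" "l \<noteq> i" for l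
    using z(2)[of "u l"] that by (auto simp: orthogonal_def intro: span_base)
  have "0 = z \<bullet> (\<Sum>i\<in>T. c i *\<^sub>R u i)" using assms(3) by simp
  also have "\<dots> = (\<Sum>l\<in>T. if l = i then c i * (z \<bullet> u i) else 0)"
    unfolding inner_sum_right by (intro sum.cong) (auto simp: 0)
  finally have "z \<bullet> u i = 0" using assms by simp
  with 0 z(1) that show ?thesis by metis
qed

text \<open>A relation \<open>c\<close> between the rows and a vector \<open>z\<close> whose
  Rayleigh quotient \<beta> for G is below every \<open>\<sigma> i - lam\<close>, \<open>i\<close>
  in \<open>T\<close>, give the direction \<open>c\<close> \<otimes> \<open>z\<close>. There the
  Hessian is 2 |z|^2 times the sum of c_i^2 (\<beta> - (\<sigma>_i - lam)), which is negative and
  contradicts minimality.\<close>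

lemma minimizer_rows_independent:
  assumes min: "x \<in> global_minimizers f"
  shows "rows_independent x"
  unfolding rows_independent_def
proof (intro allI impI ballI, rule ccontr)
  fix c0 i0 assume dep: "(\<Sum>i\<in>T. c0 i *\<^sub>R fst x $ i) = 0" and i0: "i0 \<in> T" "c0 i0 \<noteq> 0"
  note crit = grad_minimizer[OF min]
  define u where "u i = fst x $ i" for i
  \<comment> \<open>A nonzero row outside \<open>T\<close> is an eigenvector of G with a smaller
    eigenvalue. If all these rows vanish, the relation leaves room for a vector orthogonal to every
    row, with \<beta> = 0.\<close>
  obtain z \<beta> where z: "z \<noteq> 0" and sum_z: "(\<Sum>l\<in>UNIV. (z \<bullet> u l)\<^sup>2) = \<beta> * (z \<bullet> z)"
    and \<beta>: "\<And>i. i \<in> T \<Longrightarrow> \<beta> < \<sigma> i - lam"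
  proof (cases "\<exists>j. j \<notin> T \<and> u j \<noteq> 0")
    case True
    then obtain j where j: "j \<notin> T" "u j \<noteq> 0" by blast
    have "(\<Sum>l\<in>UNIV. (u j \<bullet> u l)\<^sup>2) = (\<sigma> j - lam) * (u j \<bullet> u j)"
      using arg_cong[OF critical_eigen[OF crit, of j], of "\<lambda>y. u j \<bullet> y"]
      by (simp add: inner_sum_right power2_eq_square u_def)
    with j T_gap show ?thesis by (intro that[of "u j" "\<sigma> j - lam"]) auto
  next
    case False
    obtain z where z: "z \<noteq> 0" "\<And>i. i \<in> T \<Longrightarrow> z \<bullet> u i = 0"
      using dependent_orthogonal_vector[OF i0 dep] u_def by metis
    then have "z \<bullet> u i = 0" for i using False by (cases "i \<in> T") auto
    with z T_gt show ?thesis by (intro that[of z 0]) auto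
  qed
  define c where "c i = (if i \<in> T then c0 i else 0)" for i
  have cu: "(\<Sum>i\<in>UNIV. c i *\<^sub>R u i) = 0"
    using dep by (simp add: c_def u_def if_distrib[where f="\<lambda>t. t *\<^sub>R _"] sum.If_cases cong: if_cong)
  \<comment> \<open>Along \<open>c \<otimes> z\<close> the cross terms vanish since \<open>c\<close> annihilates the rows, and the rest is negative by the choice of \<open>z\<close>.\<close>
  define h :: "(real^'r^'n) \<times> (real^'r^'m)" where
    "h = ((\<chi> i. c i *\<^sub>R z), (\<chi> j. if j \<in> range \<pi> then c (inv \<pi> j) *\<^sub>R z else 0))"
  have h1: "fst h $ i = c i *\<^sub>R z" and h2: "snd h $ \<pi> i = c i *\<^sub>R z" for i
    using inj_\<pi> by (auto simp: h_def)
  have h3: "snd h $ j = 0" if "j \<notin> range \<pi>" for j using that by (simp add: h_def)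
  have x1: "fst x $ i = u i" and x2: "snd x $ \<pi> i = u i" for i
    using critical_snd[OF crit] by (auto simp: u_def)
  note x3 = critical_snd_off_range[OF crit]
  have hh: "h \<bullet> h = 2 * (\<Sum>i\<in>UNIV. (c i)\<^sup>2 * (z \<bullet> z))"
    unfolding inner_pair_rows
    by (subst sum_over_range) (simp_all add: h1 h2 h3 power2_eq_square mult.assoc)
  have "(\<Sum>i\<in>UNIV. \<Sum>j\<in>UNIV. (lin x h i j)\<^sup>2 + 2 * res x i j * cross h i j) =
     (\<Sum>i\<in>UNIV. \<Sum>l\<in>UNIV. (lin x h i (\<pi> l))\<^sup>2 + 2 * res x i (\<pi> l) * cross h i (\<pi> l))"
    by (intro sum.cong refl sum_over_range) (simp add: lin_def cross_def h3 x3)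
  also have "\<dots> = (\<Sum>i\<in>UNIV. \<Sum>l\<in>UNIV.
       (c i)\<^sup>2 * (z \<bullet> u l)\<^sup>2 + (z \<bullet> u i)\<^sup>2 * (c l)\<^sup>2 + 2 * ((c i * (z \<bullet> u i)) * (c l * (z \<bullet> u l)))
       + 2 * (z \<bullet> z) * ((c i *\<^sub>R u i) \<bullet> (c l *\<^sub>R u l)) - (if l = i then 2 * (\<sigma> i * ((c i)\<^sup>2 * (z \<bullet> z))) else 0))"
  proof (intro sum.cong refl)
    fix i l
    have 1: "lin x h i (\<pi> l) = c i * (z \<bullet> u l) + c l * (z \<bullet> u i)"
      by (simp add: lin_def h1 h2 x1 x2 inner_commute)
    have 2: "cross h i (\<pi> l) = c i * (c l * (z \<bullet> z))"
      by (simp add: cross_def h1 h2)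
    have 3: "res x i (\<pi> l) = u i \<bullet> u l - (if l = i then \<sigma> i else 0)"
      using inj_\<pi> by (simp add: res_def target_def x1 x2 inj_eq)
    show "(lin x h i (\<pi> l))\<^sup>2 + 2 * res x i (\<pi> l) * cross h i (\<pi> l) =
       (c i)\<^sup>2 * (z \<bullet> u l)\<^sup>2 + (z \<bullet> u i)\<^sup>2 * (c l)\<^sup>2 + 2 * ((c i * (z \<bullet> u i)) * (c l * (z \<bullet> u l)))
       + 2 * (z \<bullet> z) * ((c i *\<^sub>R u i) \<bullet> (c l *\<^sub>R u l)) - (if l = i then 2 * (\<sigma> i * ((c i)\<^sup>2 * (z \<bullet> z))) else 0)"
      unfolding 1 2 3 by (cases "l = i") (simp_all add: power2_eq_square algebra_simps)
  qed
  also have "\<dots> = 2 * ((\<Sum>i\<in>UNIV. (c i)\<^sup>2) * (\<Sum>l\<in>UNIV. (z \<bullet> u l)\<^sup>2))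
     + 2 * ((\<Sum>i\<in>UNIV. c i * (z \<bullet> u i)) * (\<Sum>i\<in>UNIV. c i * (z \<bullet> u i)))
     + 2 * (z \<bullet> z) * ((\<Sum>i\<in>UNIV. c i *\<^sub>R u i) \<bullet> (\<Sum>i\<in>UNIV. c i *\<^sub>R u i))
     - 2 * (\<Sum>i\<in>UNIV. \<sigma> i * ((c i)\<^sup>2 * (z \<bullet> z)))"
  proof -
    have 1: "(\<Sum>i\<in>UNIV. \<Sum>l\<in>UNIV. (c i *\<^sub>R u i) \<bullet> (c l *\<^sub>R u l))
        = (\<Sum>i\<in>UNIV. c i *\<^sub>R u i) \<bullet> (\<Sum>i\<in>UNIV. c i *\<^sub>R u i)"
      unfolding inner_sum_left unfolding inner_sum_right by (rule refl)
    have 2: "(\<Sum>i\<in>UNIV. \<Sum>l\<in>UNIV. if l = i then 2 * (\<sigma> i * ((c i)\<^sup>2 * (z \<bullet> z))) else 0)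
       = 2 * (\<Sum>i\<in>UNIV. \<sigma> i * ((c i)\<^sup>2 * (z \<bullet> z)))"
      by (simp add: sum_distrib_left)
    show ?thesis
      by (simp only: sum.distrib sum_subtractf sum_product[symmetric] sum_distrib_left[symmetric] 1 2)
        (simp add: sum_distrib_right[symmetric])
  qed
  also have "(\<Sum>i\<in>UNIV. c i * (z \<bullet> u i)) = z \<bullet> (\<Sum>i\<in>UNIV. c i *\<^sub>R u i)"
    by (simp add: inner_sum_right)
  finally have "hess x h = 2 * (\<Sum>i\<in>UNIV. (c i)\<^sup>2 * (z \<bullet> z) * (\<beta> - (\<sigma> i - lam)))"
    unfolding hess_def hh cu sum_z
    by (simp add: sum_distrib_left sum_distrib_right sum_subtractf sum.distrib algebra_simps)
  moreover have "0 < (\<Sum>i\<in>UNIV. (c i)\<^sup>2 * (z \<bullet> z) * ((\<sigma> i - lam) - \<beta>))"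
    using i0 z \<beta> by (intro sum_pos2[of _ i0]) (auto simp: c_def less_imp_le)
  then have "(\<Sum>i\<in>UNIV. (c i)\<^sup>2 * (z \<bullet> z) * (\<beta> - (\<sigma> i - lam))) < 0"
    by (simp add: algebra_simps sum_subtractf sum.distrib)
  ultimately show False using hess_minimizer[OF min, of h] by simp
qed

lemma minimizers_optimal: "global_minimizers f \<subseteq> optimal"
  using critical_independent_optimal grad_minimizer minimizer_rows_independent by blast

section \<open>Critical points near an optimal point\<close>

lemma sum_norm_rows_le: "(\<Sum>i\<in>A. (norm (fst h $ i))\<^sup>2) \<le> (norm (h :: (real^'r^'n) \<times> (real^'r^'m)))\<^sup>2"
proof -
  have "(\<Sum>i\<in>A. (norm (fst h $ i))\<^sup>2) \<le> (\<Sum>i\<in>UNIV. (norm (fst h $ i))\<^sup>2)"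
    by (intro sum_mono2) auto
  also have "\<dots> \<le> h \<bullet> h"
    unfolding inner_pair_rows by (simp add: power2_norm_eq_inner sum_nonneg)
  finally show ?thesis by (simp add: power2_norm_eq_inner)
qed

text \<open>If \<open>c\<close> annihilates the rows of \<open>x\<close>, the same combination
  \<open>w\<close> of the rows of \<open>y\<close> equals that of the rows of y - x. Pythagoras
  gives |w|^2 as the sum of c_i^2 (\<sigma>_i - lam), while Cauchy-Schwarz bounds it by the sum of
  c_i^2 times the squared distance, which is too small.\<close>

lemma near_optimal_rows_independent:
  assumes y: "y \<in> optimal" and near: "\<And>i. i \<in> T \<Longrightarrow> (dist x y)\<^sup>2 < \<sigma> i - lam"
  shows "rows_independent x"
  unfolding rows_independent_def
proof (intro allI impI ballI, rule ccontr)
  fix c i0 assume dep: "(\<Sum>i\<in>T. c i *\<^sub>R fst x $ i) = 0" and i0: "i0 \<in> T" "c i0 \<noteq> 0"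
  define w where "w = (\<Sum>i\<in>T. c i *\<^sub>R fst y $ i)"
  have "w \<bullet> w = (\<Sum>i\<in>T. \<Sum>j\<in>T. c i * (c j * (fst y $ j \<bullet> fst y $ i)))"
    by (simp add: w_def inner_sum_left inner_sum_right sum_distrib_left)
  also have "\<dots> = (\<Sum>i\<in>T. \<Sum>j\<in>T. if i = j then c i * (c i * (\<sigma> i - lam)) else 0)"
    using y by (intro sum.cong refl) (auto simp: optimal_def)
  also have "\<dots> = (\<Sum>i\<in>T. (c i)\<^sup>2 * (\<sigma> i - lam))"
    by (simp add: power2_eq_square mult.assoc)
  finally have w2: "(norm w)\<^sup>2 = \<dots>" by (simp add: power2_norm_eq_inner)
  have "w = (\<Sum>i\<in>T. c i *\<^sub>R fst (y - x) $ i)"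
    using dep by (simp add: w_def scaleR_diff_right sum_subtractf)
  then have "norm w \<le> (\<Sum>i\<in>T. \<bar>c i\<bar> * norm (fst (y - x) $ i))"
    by (simp del: fst_diff) (rule sum_norm_le, simp)
  then have "(norm w)\<^sup>2 \<le> (\<Sum>i\<in>T. \<bar>c i\<bar> * norm (fst (y - x) $ i))\<^sup>2"
    by (intro power_mono) auto
  also have "\<dots> \<le> (\<Sum>i\<in>T. \<bar>c i\<bar>\<^sup>2) * (\<Sum>i\<in>T. (norm (fst (y - x) $ i))\<^sup>2)"
    by (rule Cauchy_Schwarz_ineq_sum)
  also have "\<dots> \<le> (\<Sum>i\<in>T. \<bar>c i\<bar>\<^sup>2) * (dist x y)\<^sup>2"
    unfolding dist_norm norm_minus_commute[of x] by (intro mult_left_mono sum_norm_rows_le sum_nonneg) auto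
  finally have "(\<Sum>i\<in>T. (c i)\<^sup>2 * ((\<sigma> i - lam) - (dist x y)\<^sup>2)) \<le> 0"
    unfolding w2 by (simp add: sum_distrib_right right_diff_distrib sum_subtractf)
  moreover have "0 < (\<Sum>i\<in>T. (c i)\<^sup>2 * ((\<sigma> i - lam) - (dist x y)\<^sup>2))"
    using i0 near by (intro sum_pos2[of _ i0]) (auto simp: less_imp_le)
  ultimately show False by simp
qed

section \<open>Displacements orthogonal to the orbit\<close>

text \<open>A rotation of the coordinate plane of \<open>p\<close> and \<open>q\<close>, when
  \<open>p\<close> and \<open>q\<close> differ and c^2 + s^2 = 1. Such rotations suffice, as their
  generators span the antisymmetric matrices.\<close>

definition rotate_plane :: "'r \<Rightarrow> 'r \<Rightarrow> real \<Rightarrow> real \<Rightarrow> real^'r \<Rightarrow> real^'r" where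
  "rotate_plane p q c s w =
     w + ((c - 1) * w $ p - s * w $ q) *\<^sub>R axis p 1 + (s * w $ p + (c - 1) * w $ q) *\<^sub>R axis q 1"

lemma inner_rotate_plane:
  "v \<bullet> rotate_plane p q c s w
     = v \<bullet> w + (c - 1) * (v $ p * w $ p + v $ q * w $ q) + s * (v $ q * w $ p - v $ p * w $ q)"
  by (simp add: rotate_plane_def inner_add_right inner_axis algebra_simps)

lemma rotate_plane_isometry:
  assumes "p \<noteq> q" "c\<^sup>2 + s\<^sup>2 = 1"
  shows "rotate_plane p q c s v \<bullet> rotate_plane p q c s w = v \<bullet> w"
proof -
  have p: "rotate_plane p q c s v $ p = c * v $ p - s * v $ q"
    and q: "rotate_plane p q c s v $ q = s * v $ p + c * v $ q"
    using assms(1) by (auto simp: rotate_plane_def axis_def algebra_simps)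
  have "rotate_plane p q c s v \<bullet> rotate_plane p q c s w
    = v \<bullet> w + (c\<^sup>2 + s\<^sup>2 - 1) * (v $ p * w $ p + v $ q * w $ q)"
    unfolding inner_rotate_plane[of "rotate_plane p q c s v"] p q
    by (simp add: inner_commute[of _ w] inner_rotate_plane power2_eq_square algebra_simps)
  then show ?thesis using assms(2) by simp
qed

lemma optimal_rotate:
  assumes "x \<in> optimal" "p \<noteq> q" "c\<^sup>2 + s\<^sup>2 = 1"
  shows "((\<chi> i. rotate_plane p q c s (fst x $ i)), (\<chi> j. rotate_plane p q c s (snd x $ j))) \<in> optimal"
proof -
  have "rotate_plane p q c s 0 = 0" by (simp add: rotate_plane_def)
  then show ?thesis
    using assms by (auto simp: optimal_def rotate_plane_isometry)
qed

text \<open>The norm is constant on \<open>optimal\<close>, so minimizing the distance to a point is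
  the same as maximizing the inner product with it.\<close>

lemma optimal_norm:
  assumes "x \<in> optimal" shows "x \<bullet> x = 2 * (\<Sum>i\<in>T. \<sigma> i - lam)"
proof -
  have "x \<bullet> x = (\<Sum>i\<in>UNIV. fst x $ i \<bullet> fst x $ i) + (\<Sum>i\<in>UNIV. fst x $ i \<bullet> fst x $ i)"
    unfolding inner_pair_rows using assms by (subst sum_over_range) (auto simp: optimal_def)
  also have "(\<Sum>i\<in>UNIV. fst x $ i \<bullet> fst x $ i) = (\<Sum>i\<in>T. fst x $ i \<bullet> fst x $ i)"
    using assms by (intro sum.mono_neutral_right) (auto simp: optimal_def)
  also have "\<dots> = (\<Sum>i\<in>T. \<sigma> i - lam)"
    using assms by (intro sum.cong) (auto simp: optimal_def)
  finally show ?thesis by simp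
qed

text \<open>At an optimal point U and V have the same rows, so only this sum of matching rows of the
  displacement enters U^T H + V^T K.\<close>

definition offset :: "(real^'r^'n) \<times> (real^'r^'m) \<Rightarrow> 'n \<Rightarrow> real^'r" where
  "offset h i = fst h $ i + snd h $ \<pi> i"

text \<open>
  For \<open>x = (U, V)\<close> with rows vanishing outside \<open>T\<close> and \<open>h = (H, K)\<close>, this says that $U^T H + V^T K$ is
  symmetric, i.e. that \<open>h\<close> is orthogonal to $(UA, VA)$ for all antisymmetric $A$.
\<close>

definition horizontal :: "(real^'r^'n) \<times> (real^'r^'m) \<Rightarrow> (real^'r^'n) \<times> (real^'r^'m) \<Rightarrow> bool" where
  "horizontal x h \<longleftrightarrow> (\<forall>a b. (\<Sum>i\<in>T. (a \<bullet> fst x $ i) * (b \<bullet> offset h i))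
                         = (\<Sum>i\<in>T. (b \<bullet> fst x $ i) * (a \<bullet> offset h i)))"

text \<open>The point \<open>x\<close> maximizes the inner product with x + h over
  \<open>optimal\<close>. Rotating \<open>x\<close> changes it by (c - 1) A + s B, which is
  nonpositive on the unit circle only if B = 0; and B is an entry of the antisymmetric part of U^T H
  + V^T K.\<close>

lemma closest_horizontal:
  assumes x: "x \<in> optimal" and closest: "\<And>y. y \<in> optimal \<Longrightarrow> dist (x + h) x \<le> dist (x + h) y"
  shows "horizontal x h"
proof -
  let ?z = "x + h"
  have max: "?z \<bullet> y \<le> ?z \<bullet> x" if "y \<in> optimal" for y
  proof -
    have "(dist ?z x)\<^sup>2 \<le> (dist ?z y)\<^sup>2"
      using closest[OF that] by (intro power_mono) auto
    moreover have "(dist ?z w)\<^sup>2 = ?z \<bullet> ?z + w \<bullet> w - 2 * (?z \<bullet> w)" for w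
      unfolding dist_norm power2_norm_eq_inner
      by (simp add: inner_diff_left inner_diff_right inner_commute)
    ultimately show ?thesis
      using optimal_norm[OF x] optimal_norm[OF that] by simp
  qed
  have coord: "(\<Sum>i\<in>T. fst x $ i $ p * offset h i $ q) = (\<Sum>i\<in>T. fst x $ i $ q * offset h i $ p)" for p q
  proof (cases "p = q")
    case False
    define A where "A = (\<Sum>i\<in>UNIV. fst ?z $ i $ p * fst x $ i $ p + fst ?z $ i $ q * fst x $ i $ q)
      + (\<Sum>j\<in>UNIV. snd ?z $ j $ p * snd x $ j $ p + snd ?z $ j $ q * snd x $ j $ q)"
    define B where "B = (\<Sum>i\<in>UNIV. fst ?z $ i $ q * fst x $ i $ p - fst ?z $ i $ p * fst x $ i $ q)
      + (\<Sum>j\<in>UNIV. snd ?z $ j $ q * snd x $ j $ p - snd ?z $ j $ p * snd x $ j $ q)"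
    have rot: "(c - 1) * A + s * B \<le> 0" if "c\<^sup>2 + s\<^sup>2 = 1" for c s :: real
    proof -
      have "?z \<bullet> x + ((c - 1) * A + s * B) \<le> ?z \<bullet> x"
        using max[OF optimal_rotate[OF x False that]]
        unfolding inner_pair_rows[of ?z] A_def B_def
        by (simp add: inner_rotate_plane sum.distrib sum_distrib_left[symmetric] distrib_left del: fst_add snd_add)
      then show ?thesis by simp
    qed
    have "B = 0"
    proof (rule ccontr)
      assume "B \<noteq> 0"
      define r where "r = sqrt (A\<^sup>2 + B\<^sup>2)"
      have r2: "r\<^sup>2 = A\<^sup>2 + B\<^sup>2" and "r > 0"
        using \<open>B \<noteq> 0\<close> by (auto simp: r_def add_nonneg_pos)
      \<comment> \<open>this angle maximizes \<open>c * A + s * B\<close>, with maximum \<open>r > A\<close>\<close>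
      have "(A / r - 1) * A + B / r * B \<le> 0"
        using \<open>r > 0\<close> \<open>B \<noteq> 0\<close> r2 by (intro rot) (simp add: power_divide add_divide_distrib[symmetric])
      then have "(A\<^sup>2 + B\<^sup>2) / r \<le> A"
        by (simp add: power2_eq_square algebra_simps add_divide_distrib)
      then have "r\<^sup>2 / r \<le> A" by (simp only: r2)
      then have "r \<le> A" using \<open>r > 0\<close> by (simp add: power2_eq_square)
      then have "r\<^sup>2 \<le> A\<^sup>2" using \<open>r > 0\<close> by (intro power_mono) auto
      then show False using r2 \<open>B \<noteq> 0\<close> by simp
    qed
    \<comment> \<open>The contribution of \<open>x\<close> itself to B is symmetric in
      \<open>p\<close> and \<open>q\<close> and cancels, leaving \<open>h\<close>.\<close>
    moreover have "B = (\<Sum>i\<in>UNIV. fst x $ i $ p * offset h i $ q - fst x $ i $ q * offset h i $ p)"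
      unfolding B_def using x
      by (subst sum_over_range) (auto simp: optimal_def offset_def algebra_simps simp flip: sum.distrib)
    moreover have "\<dots> = (\<Sum>i\<in>T. fst x $ i $ p * offset h i $ q - fst x $ i $ q * offset h i $ p)"
      using x by (intro sum.mono_neutral_right) (auto simp: optimal_def)
    ultimately show ?thesis by (simp add: sum_subtractf)
  qed simp
  have bil: "(\<Sum>i\<in>T. (a \<bullet> fst x $ i) * (b \<bullet> offset h i))
      = (\<Sum>p\<in>UNIV. \<Sum>q\<in>UNIV. a $ p * b $ q * (\<Sum>i\<in>T. fst x $ i $ p * offset h i $ q))" for a b
  proof -
    have "(\<Sum>i\<in>T. (a \<bullet> fst x $ i) * (b \<bullet> offset h i))
      = (\<Sum>i\<in>T. \<Sum>p\<in>UNIV. \<Sum>q\<in>UNIV. a $ p * b $ q * (fst x $ i $ p * offset h i $ q))"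
      by (simp add: inner_vec_def sum_product mult_ac)
    also have "\<dots> = (\<Sum>p\<in>UNIV. \<Sum>i\<in>T. \<Sum>q\<in>UNIV. a $ p * b $ q * (fst x $ i $ p * offset h i $ q))"
      by (rule sum.swap)
    also have "\<dots> = (\<Sum>p\<in>UNIV. \<Sum>q\<in>UNIV. \<Sum>i\<in>T. a $ p * b $ q * (fst x $ i $ p * offset h i $ q))"
      by (intro sum.cong refl sum.swap)
    finally show ?thesis by (simp add: sum_distrib_left)
  qed
  show ?thesis
    unfolding horizontal_def
  proof (intro allI)
    fix a b
    show "(\<Sum>i\<in>T. (a \<bullet> fst x $ i) * (b \<bullet> offset h i)) = (\<Sum>i\<in>T. (b \<bullet> fst x $ i) * (a \<bullet> offset h i))"
      unfolding bil by (subst sum.swap) (simp add: coord mult_ac)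
  qed
qed

text \<open>The rows form an orthogonal basis, so |y|^2 is the sum of (y . u_l)^2 / a_l.\<close>

lemma full_frame_bound:
  fixes u :: "'n \<Rightarrow> real^'r"
  assumes card: "card T = CARD('r)"
    and orth: "\<And>i j. i \<in> T \<Longrightarrow> j \<in> T \<Longrightarrow> u i \<bullet> u j = (if i = j then a i else 0)"
    and pos: "\<And>i. i \<in> T \<Longrightarrow> 0 < a i" and t: "\<And>i. i \<in> T \<Longrightarrow> t \<le> a i"
  shows "t * (y \<bullet> y) \<le> (\<Sum>l\<in>T. (y \<bullet> u l)\<^sup>2)"
proof -
  have "y - (\<Sum>l\<in>T. (y \<bullet> u l / a l) *\<^sub>R u l) = 0"
  proof (rule orthogonal_to_full_frame[OF card])
    fix i assume i: "i \<in> T"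
    have "u i \<bullet> (\<Sum>l\<in>T. (y \<bullet> u l / a l) *\<^sub>R u l) = (\<Sum>l\<in>T. if l = i then y \<bullet> u i else 0)"
      unfolding inner_sum_right using i pos[OF i] by (intro sum.cong) (auto simp: orth)
    then show "u i \<bullet> (y - (\<Sum>l\<in>T. (y \<bullet> u l / a l) *\<^sub>R u l)) = 0"
      using i by (simp add: inner_diff_right inner_commute)
    show "u i \<noteq> 0" using orth[OF i i] pos[OF i] by auto
  qed (use orth in auto)
  then have "y \<bullet> y = y \<bullet> (\<Sum>l\<in>T. (y \<bullet> u l / a l) *\<^sub>R u l)" by simp
  then have "t * (y \<bullet> y) = (\<Sum>l\<in>T. t / a l * (y \<bullet> u l)\<^sup>2)"
    by (simp add: inner_sum_right sum_distrib_left power2_eq_square)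
  also have "\<dots> \<le> (\<Sum>l\<in>T. 1 * (y \<bullet> u l)\<^sup>2)"
    using pos t by (intro sum_mono mult_right_mono) auto
  finally show ?thesis by simp
qed

text \<open>Minima over finitely many indices; inserting 1 keeps the sets nonempty. When
  \<open>T\<close> has CARD('r) elements, the gap is measured against the values in \<open>T\<close>
  instead of \<open>lam\<close>.\<close>

lemma uniform_gaps:
  obtains \<alpha> \<gamma> where "0 < \<alpha>" "\<And>i. i \<in> T \<Longrightarrow> \<alpha> \<le> \<sigma> i - lam" "0 < \<gamma>"
    "\<And>i. i \<notin> T \<Longrightarrow> \<sigma> i + \<gamma> \<le> lam \<or> (card T = CARD('r) \<and> (\<forall>l\<in>T. \<sigma> i + \<gamma> \<le> \<sigma> l))"
proof -
  define \<alpha> where "\<alpha> = Min (insert 1 ((\<lambda>i. \<sigma> i - lam) ` T))"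
  have \<alpha>: "0 < \<alpha>" "\<And>i. i \<in> T \<Longrightarrow> \<alpha> \<le> \<sigma> i - lam"
    using T_gt by (auto simp: \<alpha>_def)
  show ?thesis
    using outside
  proof
    assume *: "\<forall>j. j \<notin> T \<longrightarrow> \<sigma> j < lam"
    define \<gamma> where "\<gamma> = Min (insert 1 ((\<lambda>i. lam - \<sigma> i) ` (- T)))"
    have "0 < \<gamma>" using * by (auto simp: \<gamma>_def)
    moreover have "\<gamma> \<le> lam - \<sigma> i" if "i \<notin> T" for i using that by (auto simp: \<gamma>_def)
    ultimately show ?thesis using \<alpha> by (intro that[of \<alpha> \<gamma>]) (auto simp: algebra_simps)
  next
    assume *: "card T = CARD('r)"
    define \<gamma> where "\<gamma> = Min (insert 1 ((\<lambda>(i, l). \<sigma> l - \<sigma> i) ` ((- T) \<times> T)))"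
    have "0 < \<gamma>" using T_gap by (auto simp: \<gamma>_def)
    moreover have "\<gamma> \<le> \<sigma> l - \<sigma> i" if "i \<notin> T" "l \<in> T" for i l
      unfolding \<gamma>_def using that by (intro Min_le) force+
    ultimately show ?thesis using \<alpha> * by (intro that[of \<alpha> \<gamma>]) (auto simp: algebra_simps)
  qed
qed

section \<open>Lower bound for the Hessian\<close>

lemma sum_split_range:
  "(\<Sum>j\<in>UNIV. F j) = (\<Sum>i\<in>UNIV. F (\<pi> i)) + (\<Sum>j\<in>- range \<pi>. F j :: real)"
  using sum.subset_diff[of "range \<pi>" UNIV F]
  by (simp add: sum.reindex[OF inj_\<pi>] Compl_eq_Diff_UNIV add.commute)

lemma sum_split_T: "(\<Sum>i\<in>UNIV. F i) = (\<Sum>i\<in>T. F i) + (\<Sum>i\<in>- T. F i :: real)"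
  using sum.subset_diff[of T UNIV F] by (simp add: Compl_eq_Diff_UNIV add.commute)

text \<open>Symmetrizing \<open>lin\<close> in the two indices yields N i l + N l i. Horizontality
  makes the two summands proportional with a positive factor, so their squares are controlled
  separately.\<close>

lemma horizontal_block:
  assumes x: "x \<in> optimal" and hor: "horizontal x h"
    and \<alpha>: "0 < \<alpha>" "\<And>i. i \<in> T \<Longrightarrow> \<alpha> \<le> \<sigma> i - lam"
  shows "\<alpha> / 2 * (\<Sum>i\<in>T. offset h i \<bullet> offset h i) \<le> (\<Sum>i\<in>T. \<Sum>l\<in>T. (lin x h i (\<pi> l))\<^sup>2)"
proof -
  define u where "u i = fst x $ i" for i
  define N where "N i l = offset h i \<bullet> u l" for i l
  have gram: "u i \<bullet> u j = (if i = j then \<sigma> i - lam else 0)" if "i \<in> T" "j \<in> T" for i j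
    using x that by (auto simp: optimal_def u_def)
  have pos: "0 < \<sigma> i - lam" if "i \<in> T" for i using T_gt[OF that] by simp
  have N_sym: "(\<sigma> i - lam) * N i l = (\<sigma> l - lam) * N l i" if "i \<in> T" "l \<in> T" for i l
  proof -
    have "(\<Sum>k\<in>T. (u i \<bullet> u k) * (u l \<bullet> offset h k)) = (\<Sum>k\<in>T. (u l \<bullet> u k) * (u i \<bullet> offset h k))"
      using hor by (simp add: horizontal_def u_def)
    moreover have "(\<Sum>k\<in>T. (u i \<bullet> u k) * (u l \<bullet> offset h k)) = (\<Sum>k\<in>T. if i = k then (\<sigma> i - lam) * N i l else 0)"
      using that by (intro sum.cong) (auto simp: gram N_def inner_commute)
    moreover have "(\<Sum>k\<in>T. (u l \<bullet> u k) * (u i \<bullet> offset h k)) = (\<Sum>k\<in>T. if l = k then (\<sigma> l - lam) * N l i else 0)"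
      using that by (intro sum.cong) (auto simp: gram N_def inner_commute)
    ultimately show ?thesis using that by simp
  qed
  \<comment> \<open>hence squaring \<open>N i l + N l i\<close> loses nothing, although the Hessian only controls this sum\<close>
  have same_sign: "0 \<le> N i l * N l i" if "i \<in> T" "l \<in> T" for i l
  proof -
    have "(\<sigma> l - lam) * (N i l * N l i) = N i l * ((\<sigma> l - lam) * N l i)" by simp
    also have "\<dots> = (\<sigma> i - lam) * (N i l)\<^sup>2"
      unfolding N_sym[OF that, symmetric] by (simp add: power2_eq_square)
    finally have "(\<sigma> l - lam) * (N i l * N l i) = (\<sigma> i - lam) * (N i l)\<^sup>2" .
    then have "0 \<le> (\<sigma> l - lam) * (N i l * N l i)" using pos[OF \<open>i \<in> T\<close>] by simp
    then show ?thesis using pos[OF \<open>l \<in> T\<close>] by (simp add: zero_le_mult_iff)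
  qed
  \<comment> \<open>Testing horizontality with row \<open>i\<close> and \<open>offset h i\<close>
    gives a Parseval identity: the offset lies in the span of the rows in \<open>T\<close>, even if
    they do not fill the space.\<close>
  have row: "\<alpha> * (offset h i \<bullet> offset h i) \<le> (\<Sum>l\<in>T. (N i l)\<^sup>2)" if i: "i \<in> T" for i
  proof -
    have "(\<Sum>k\<in>T. (u i \<bullet> u k) * (offset h i \<bullet> offset h k)) = (\<Sum>k\<in>T. (offset h i \<bullet> u k) * (u i \<bullet> offset h k))"
      using hor by (simp add: horizontal_def u_def)
    moreover have "(\<Sum>k\<in>T. (u i \<bullet> u k) * (offset h i \<bullet> offset h k))
        = (\<Sum>k\<in>T. if i = k then (\<sigma> i - lam) * (offset h i \<bullet> offset h i) else 0)"
      using i by (intro sum.cong) (auto simp: gram)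
    moreover have "(\<Sum>k\<in>T. (offset h i \<bullet> u k) * (u i \<bullet> offset h k))
        = (\<Sum>k\<in>T. (\<sigma> i - lam) * ((N i k)\<^sup>2 / (\<sigma> k - lam)))"
    proof (intro sum.cong refl)
      fix k assume k: "k \<in> T"
      have "N k i = (\<sigma> i - lam) * N i k / (\<sigma> k - lam)"
        using N_sym[OF i k] pos[OF k] by (simp add: field_simps)
      then show "(offset h i \<bullet> u k) * (u i \<bullet> offset h k) = (\<sigma> i - lam) * ((N i k)\<^sup>2 / (\<sigma> k - lam))"
        by (simp add: N_def[symmetric] inner_commute[of "u i"] power2_eq_square)
    qed
    ultimately have "(\<sigma> i - lam) * (offset h i \<bullet> offset h i)
        = (\<sigma> i - lam) * (\<Sum>k\<in>T. (N i k)\<^sup>2 / (\<sigma> k - lam))"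
      using i by (simp add: sum_distrib_left)
    then have "offset h i \<bullet> offset h i = (\<Sum>k\<in>T. (N i k)\<^sup>2 / (\<sigma> k - lam))"
      using pos[OF i] by simp
    then have "\<alpha> * (offset h i \<bullet> offset h i) = (\<Sum>k\<in>T. \<alpha> / (\<sigma> k - lam) * (N i k)\<^sup>2)"
      by (simp add: sum_distrib_left)
    also have "\<dots> \<le> (\<Sum>k\<in>T. 1 * (N i k)\<^sup>2)"
      using pos \<alpha> by (intro sum_mono mult_right_mono) auto
    finally show ?thesis by simp
  qed
  have entry: "(N i l)\<^sup>2 + (N l i)\<^sup>2 \<le> 2 * (lin x h i (\<pi> l))\<^sup>2 + 2 * (lin x h l (\<pi> i))\<^sup>2"
    if "i \<in> T" "l \<in> T" for i l
  proof -
    have "N i l + N l i = lin x h i (\<pi> l) + lin x h l (\<pi> i)"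
      using x by (simp add: N_def lin_def offset_def u_def optimal_def inner_add_left inner_add_right inner_commute)
    then have "(N i l)\<^sup>2 + (N l i)\<^sup>2 + 2 * (N i l * N l i) = (lin x h i (\<pi> l) + lin x h l (\<pi> i))\<^sup>2"
      by (metis power2_sum mult.assoc)
    moreover have "0 \<le> (lin x h i (\<pi> l) - lin x h l (\<pi> i))\<^sup>2" by simp
    ultimately show ?thesis
      using same_sign[OF that] by (simp add: power2_sum power2_diff)
  qed
  have "(\<Sum>i\<in>T. \<Sum>l\<in>T. (N i l)\<^sup>2) + (\<Sum>i\<in>T. \<Sum>l\<in>T. (N l i)\<^sup>2)
      \<le> 2 * (\<Sum>i\<in>T. \<Sum>l\<in>T. (lin x h i (\<pi> l))\<^sup>2) + 2 * (\<Sum>i\<in>T. \<Sum>l\<in>T. (lin x h l (\<pi> i))\<^sup>2)"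
    unfolding sum_distrib_left sum.distrib[symmetric] by (intro sum_mono entry)
  moreover have "(\<Sum>i\<in>T. \<Sum>l\<in>T. (N l i)\<^sup>2) = (\<Sum>i\<in>T. \<Sum>l\<in>T. (N i l)\<^sup>2)"
    by (rule sum.swap)
  moreover have "(\<Sum>i\<in>T. \<Sum>l\<in>T. (lin x h l (\<pi> i))\<^sup>2) = (\<Sum>i\<in>T. \<Sum>l\<in>T. (lin x h i (\<pi> l))\<^sup>2)"
    by (rule sum.swap)
  moreover have "\<alpha> * (\<Sum>i\<in>T. offset h i \<bullet> offset h i) \<le> (\<Sum>i\<in>T. \<Sum>l\<in>T. (N i l)\<^sup>2)"
    unfolding sum_distrib_left by (intro sum_mono row)
  ultimately show ?thesis by simp
qed

lemma two_inner_le: "2 * (v \<bullet> w) \<le> v \<bullet> v + w \<bullet> (w::real^'r)"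
  using inner_ge_zero[of "v - w"] by (simp add: inner_diff_left inner_diff_right inner_commute)

text \<open>At an optimal point the residual is diagonal, so the Hessian splits into the squares of
  \<open>lin\<close> and one term per row of \<open>h\<close>. In \<open>T\<close> the sum of the
  two matching rows is controlled by \<open>horizontal_block\<close> and their difference by
  \<open>lam\<close>; the other rows are controlled by the spectral gap, and columns off the
  diagonal by \<open>lam\<close>.\<close>

lemma hess_lower_bound:
  obtains \<kappa> where "0 < \<kappa>"
    "\<And>x h. x \<in> optimal \<Longrightarrow> horizontal x h \<Longrightarrow> \<kappa> * (h \<bullet> h) \<le> hess x h"
proof -
  obtain \<alpha> \<gamma> where \<alpha>: "0 < \<alpha>" "\<And>i. i \<in> T \<Longrightarrow> \<alpha> \<le> \<sigma> i - lam" and \<gamma>: "0 < \<gamma>"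
    "\<And>i. i \<notin> T \<Longrightarrow> \<sigma> i + \<gamma> \<le> lam \<or> (card T = CARD('r) \<and> (\<forall>l\<in>T. \<sigma> i + \<gamma> \<le> \<sigma> l))"
    using uniform_gaps by blast
  define \<kappa> where "\<kappa> = min \<alpha> (min \<gamma> lam)"
  have \<kappa>: "0 < \<kappa>" "\<kappa> \<le> \<alpha>" "\<kappa> \<le> \<gamma>" "\<kappa> \<le> lam"
    using \<alpha> \<gamma> lam_pos by (auto simp: \<kappa>_def)
  show ?thesis
  proof (rule that[OF \<kappa>(1)])
    fix x h assume x: "x \<in> optimal" and hor: "horizontal x h"
    define u where "u i = fst x $ i" for i
    define p where "p i = fst h $ i" for i
    define q where "q i = snd h $ \<pi> i" for i
    define E where "E = (\<Sum>j\<in>- range \<pi>. snd h $ j \<bullet> snd h $ j)"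
    \<comment> \<open>The negated diagonal residual: in \<open>T\<close> it is \<sigma>_i -
      (\<sigma>_i - lam) = lam.\<close>
    define \<tau> where "\<tau> i = (if i \<in> T then lam else \<sigma> i)" for i
    have x2: "snd x $ \<pi> i = u i" and x3: "j \<notin> range \<pi> \<Longrightarrow> snd x $ j = 0"
      and u0: "i \<notin> T \<Longrightarrow> u i = 0" for i j
      using x by (auto simp: optimal_def u_def)
    have gram: "u i \<bullet> u j = (if i = j then \<sigma> i - lam else 0)" if "i \<in> T" "j \<in> T" for i j
      using x that by (auto simp: optimal_def u_def)
    have E: "0 \<le> E" by (simp add: E_def sum_nonneg)
    have hh: "h \<bullet> h = (\<Sum>i\<in>UNIV. p i \<bullet> p i + q i \<bullet> q i) + E"
      unfolding inner_pair_rows by (subst sum_split_range) (simp add: p_def q_def E_def sum.distrib)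
    have lin_eq: "lin x h i (\<pi> l) = p i \<bullet> u l + u i \<bullet> q l" for i l
      by (simp add: lin_def p_def q_def u_def[symmetric] x2)
    have res_eq: "res x i (\<pi> l) = (if l = i then - \<tau> i else 0)" for i l
      using inj_\<pi> u0[of i] u0[of l] gram[of i l]
      by (cases "l \<in> T") (auto simp: res_def target_def x2 \<tau>_def inj_eq u_def[symmetric])
    have "(\<Sum>i\<in>UNIV. \<Sum>l\<in>UNIV. (lin x h i (\<pi> l))\<^sup>2) - (\<Sum>i\<in>UNIV. 2 * \<tau> i * (p i \<bullet> q i))
      = (\<Sum>i\<in>UNIV. \<Sum>l\<in>UNIV. (lin x h i (\<pi> l))\<^sup>2 - (if l = i then 2 * \<tau> i * (p i \<bullet> q i) else 0))"
      by (simp add: sum_subtractf)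
    also have "\<dots> = (\<Sum>i\<in>UNIV. \<Sum>l\<in>UNIV. (lin x h i (\<pi> l))\<^sup>2 + 2 * res x i (\<pi> l) * cross h i (\<pi> l))"
      by (intro sum.cong refl) (auto simp: res_eq cross_def p_def q_def)
    also have "\<dots> \<le> (\<Sum>i\<in>UNIV. \<Sum>j\<in>UNIV. (lin x h i j)\<^sup>2 + 2 * res x i j * cross h i j)"
    proof (rule sum_mono)
      fix i
      have "0 \<le> (lin x h i j)\<^sup>2 + 2 * res x i j * cross h i j" if "j \<in> - range \<pi>" for j
      proof -
        have "res x i j = 0" using that x3 by (auto simp: res_def target_def)
        then show ?thesis by simp
      qed
      then have "0 \<le> (\<Sum>j\<in>- range \<pi>. (lin x h i j)\<^sup>2 + 2 * res x i j * cross h i j)"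
        by (rule sum_nonneg)
      then show "(\<Sum>l\<in>UNIV. (lin x h i (\<pi> l))\<^sup>2 + 2 * res x i (\<pi> l) * cross h i (\<pi> l))
          \<le> (\<Sum>j\<in>UNIV. (lin x h i j)\<^sup>2 + 2 * res x i j * cross h i j)"
        by (subst sum_split_range) simp
    qed
    finally have low: "(\<Sum>i\<in>UNIV. \<Sum>l\<in>UNIV. (lin x h i (\<pi> l))\<^sup>2)
        + (\<Sum>i\<in>UNIV. lam * (p i \<bullet> p i + q i \<bullet> q i) - 2 * \<tau> i * (p i \<bullet> q i)) + lam * E \<le> hess x h"
      unfolding hess_def hh by (simp add: sum_subtractf sum_distrib_left distrib_left)
    have "(\<Sum>i\<in>UNIV. \<Sum>l\<in>UNIV. (lin x h i (\<pi> l))\<^sup>2)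
       = (\<Sum>i\<in>T. \<Sum>l\<in>T. (lin x h i (\<pi> l))\<^sup>2) + (\<Sum>i\<in>T. \<Sum>l\<in>- T. (lin x h i (\<pi> l))\<^sup>2)
         + (\<Sum>i\<in>- T. \<Sum>l\<in>T. (lin x h i (\<pi> l))\<^sup>2) + (\<Sum>i\<in>- T. \<Sum>l\<in>- T. (lin x h i (\<pi> l))\<^sup>2)"
      by (simp add: sum_split_T sum.distrib)
    moreover have "(\<Sum>i\<in>- T. \<Sum>l\<in>- T. (lin x h i (\<pi> l))\<^sup>2) = 0"
      by (intro sum.neutral ballI) (simp add: lin_eq u0)
    moreover have "(\<Sum>i\<in>T. \<Sum>l\<in>- T. (lin x h i (\<pi> l))\<^sup>2) = (\<Sum>i\<in>- T. \<Sum>l\<in>T. (q i \<bullet> u l)\<^sup>2)"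
      by (subst sum.swap) (simp add: lin_eq u0 inner_commute)
    moreover have "(\<Sum>i\<in>- T. \<Sum>l\<in>T. (lin x h i (\<pi> l))\<^sup>2) = (\<Sum>i\<in>- T. \<Sum>l\<in>T. (p i \<bullet> u l)\<^sup>2)"
      by (simp add: lin_eq u0)
    ultimately have split: "(\<Sum>i\<in>UNIV. \<Sum>l\<in>UNIV. (lin x h i (\<pi> l))\<^sup>2)
       = (\<Sum>i\<in>T. \<Sum>l\<in>T. (lin x h i (\<pi> l))\<^sup>2)
         + (\<Sum>i\<in>- T. (\<Sum>l\<in>T. (p i \<bullet> u l)\<^sup>2) + (\<Sum>l\<in>T. (q i \<bullet> u l)\<^sup>2))"
      by (simp add: sum.distrib)
    \<comment> \<open>If \<sigma>_i is close to or above \<open>lam\<close>, the regularizer cannot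
      absorb the residual term; then the rows in \<open>T\<close> form a full frame and the squares
      of \<open>lin\<close> supply the missing \<sigma>_i + \<gamma> - lam.\<close>
    have off: "\<gamma> * (p i \<bullet> p i + q i \<bullet> q i) \<le> (\<Sum>l\<in>T. (p i \<bullet> u l)\<^sup>2) + (\<Sum>l\<in>T. (q i \<bullet> u l)\<^sup>2)
        + (lam * (p i \<bullet> p i + q i \<bullet> q i) - 2 * \<tau> i * (p i \<bullet> q i))" if "i \<notin> T" for i
    proof -
      have frame: "(\<sigma> i + \<gamma> - lam) * (y \<bullet> y) \<le> (\<Sum>l\<in>T. (y \<bullet> u l)\<^sup>2)" for y
        using \<gamma>(2)[OF that]
      proof
        assume "\<sigma> i + \<gamma> \<le> lam"
        then have "(\<sigma> i + \<gamma> - lam) * (y \<bullet> y) \<le> 0" by (simp add: mult_nonpos_nonneg)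
        also have "\<dots> \<le> (\<Sum>l\<in>T. (y \<bullet> u l)\<^sup>2)" by (simp add: sum_nonneg)
        finally show ?thesis .
      next
        assume "card T = CARD('r) \<and> (\<forall>l\<in>T. \<sigma> i + \<gamma> \<le> \<sigma> l)"
        then show ?thesis
          using T_gt by (intro full_frame_bound[where a="\<lambda>l. \<sigma> l - lam"]) (auto simp: gram)
      qed
      have "\<sigma> i * (2 * (p i \<bullet> q i)) \<le> \<sigma> i * (p i \<bullet> p i + q i \<bullet> q i)"
        by (intro mult_left_mono two_inner_le \<sigma>_nonneg)
      then show ?thesis
        using frame[of "p i"] frame[of "q i"] that by (simp add: \<tau>_def algebra_simps)
    qed
    \<comment> \<open>Parallelogram law: the squared lengths of sum and difference bound those of
      \<open>p i\<close> and \<open>q i\<close>.\<close>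
    have on: "\<kappa> * (p i \<bullet> p i + q i \<bullet> q i)
        \<le> \<alpha> / 2 * (offset h i \<bullet> offset h i) + (lam * (p i \<bullet> p i + q i \<bullet> q i) - 2 * \<tau> i * (p i \<bullet> q i))"
      if "i \<in> T" for i
    proof -
      define d where "d = p i - q i"
      have s: "offset h i \<bullet> offset h i = p i \<bullet> p i + q i \<bullet> q i + 2 * (p i \<bullet> q i)"
        by (simp add: offset_def p_def q_def inner_add_left inner_add_right inner_commute)
      have d: "d \<bullet> d = p i \<bullet> p i + q i \<bullet> q i - 2 * (p i \<bullet> q i)"
        by (simp add: d_def inner_diff_left inner_diff_right inner_commute)
      have "\<kappa> / 2 * (offset h i \<bullet> offset h i) \<le> \<alpha> / 2 * (offset h i \<bullet> offset h i)"
        using \<kappa> by (intro mult_right_mono) auto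
      moreover have "\<kappa> / 2 * (d \<bullet> d) \<le> lam * (d \<bullet> d)"
        using \<kappa> by (intro mult_right_mono) auto
      moreover have "\<kappa> * (p i \<bullet> p i + q i \<bullet> q i) = \<kappa> / 2 * (offset h i \<bullet> offset h i) + \<kappa> / 2 * (d \<bullet> d)"
        unfolding s d by (simp add: algebra_simps)
      moreover have "lam * (p i \<bullet> p i + q i \<bullet> q i) - 2 * \<tau> i * (p i \<bullet> q i) = lam * (d \<bullet> d)"
        using that unfolding d by (simp add: \<tau>_def algebra_simps)
      ultimately show ?thesis by linarith
    qed
    have "\<kappa> * (h \<bullet> h) = (\<Sum>i\<in>T. \<kappa> * (p i \<bullet> p i + q i \<bullet> q i)) + (\<Sum>i\<in>- T. \<kappa> * (p i \<bullet> p i + q i \<bullet> q i)) + \<kappa> * E"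
      unfolding hh by (simp only: sum_split_T distrib_left sum_distrib_left)
    also have "\<dots> \<le> (\<Sum>i\<in>T. \<alpha> / 2 * (offset h i \<bullet> offset h i) + (lam * (p i \<bullet> p i + q i \<bullet> q i) - 2 * \<tau> i * (p i \<bullet> q i)))
       + (\<Sum>i\<in>- T. (\<Sum>l\<in>T. (p i \<bullet> u l)\<^sup>2) + (\<Sum>l\<in>T. (q i \<bullet> u l)\<^sup>2)
            + (lam * (p i \<bullet> p i + q i \<bullet> q i) - 2 * \<tau> i * (p i \<bullet> q i))) + lam * E"
    proof (intro add_mono sum_mono on)
      show "\<kappa> * E \<le> lam * E" using \<kappa> E by (intro mult_right_mono)
      fix i assume "i \<in> - T"
      have "\<kappa> * (p i \<bullet> p i + q i \<bullet> q i) \<le> \<gamma> * (p i \<bullet> p i + q i \<bullet> q i)"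
        using \<kappa> by (intro mult_right_mono) auto
      also note off[of i]
      finally show "\<kappa> * (p i \<bullet> p i + q i \<bullet> q i) \<le> (\<Sum>l\<in>T. (p i \<bullet> u l)\<^sup>2) + (\<Sum>l\<in>T. (q i \<bullet> u l)\<^sup>2)
        + (lam * (p i \<bullet> p i + q i \<bullet> q i) - 2 * \<tau> i * (p i \<bullet> q i))"
        using \<open>i \<in> - T\<close> by simp
    qed
    also have "\<dots> = \<alpha> / 2 * (\<Sum>i\<in>T. offset h i \<bullet> offset h i)
       + (\<Sum>i\<in>- T. (\<Sum>l\<in>T. (p i \<bullet> u l)\<^sup>2) + (\<Sum>l\<in>T. (q i \<bullet> u l)\<^sup>2))
       + (\<Sum>i\<in>UNIV. lam * (p i \<bullet> p i + q i \<bullet> q i) - 2 * \<tau> i * (p i \<bullet> q i)) + lam * E"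
      unfolding sum.distrib sum_split_T[of "\<lambda>i. lam * (p i \<bullet> p i + q i \<bullet> q i) - 2 * \<tau> i * (p i \<bullet> q i)"]
        sum_distrib_left by simp
    also have "\<dots> \<le> (\<Sum>i\<in>UNIV. \<Sum>l\<in>UNIV. (lin x h i (\<pi> l))\<^sup>2)
        + (\<Sum>i\<in>UNIV. lam * (p i \<bullet> p i + q i \<bullet> q i) - 2 * \<tau> i * (p i \<bullet> q i)) + lam * E"
      unfolding split using horizontal_block[OF x hor \<alpha>] by simp
    also note low
    finally show "\<kappa> * (h \<bullet> h) \<le> hess x h" .
  qed
qed

section \<open>Norm bounds for the Taylor terms\<close>

lemma norm_row_le:
  fixes y :: "(real^'r^'n) \<times> (real^'r^'m)"
  shows "norm (fst y $ i) \<le> norm y" "norm (snd y $ j) \<le> norm y"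
  using order_trans[OF Finite_Cartesian_Product.norm_nth_le norm_fst_le[of "fst y" "snd y"]]
    order_trans[OF Finite_Cartesian_Product.norm_nth_le norm_snd_le[of "snd y" "fst y"]]
  by simp_all

lemma lin_bound:
  assumes "norm x \<le> B" shows "\<bar>lin x h i j\<bar> \<le> 2 * B * norm h"
proof -
  have "0 \<le> B" using norm_ge_zero assms by (rule order_trans)
  have "\<bar>fst h $ i \<bullet> snd x $ j\<bar> \<le> norm (fst h $ i) * norm (snd x $ j)"
    by (rule Cauchy_Schwarz_ineq2)
  also have "\<dots> \<le> norm h * B"
    by (intro mult_mono norm_row_le order_trans[OF norm_row_le(2) assms]) auto
  finally have "\<bar>fst h $ i \<bullet> snd x $ j\<bar> \<le> B * norm h"
    by (simp add: mult.commute)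
  moreover have "\<bar>fst x $ i \<bullet> snd h $ j\<bar> \<le> norm (fst x $ i) * norm (snd h $ j)"
    by (rule Cauchy_Schwarz_ineq2)
  moreover have "norm (fst x $ i) * norm (snd h $ j) \<le> B * norm h"
    by (intro mult_mono norm_row_le order_trans[OF norm_row_le(1) assms]) (use \<open>0 \<le> B\<close> in auto)
  ultimately show ?thesis unfolding lin_def by linarith
qed

lemma cross_bound: "\<bar>cross h i j\<bar> \<le> (norm h)\<^sup>2"
proof -
  have "\<bar>cross h i j\<bar> \<le> norm (fst h $ i) * norm (snd h $ j)"
    unfolding cross_def by (rule Cauchy_Schwarz_ineq2)
  also have "\<dots> \<le> norm h * norm h"
    by (intro mult_mono norm_row_le) auto
  finally show ?thesis by (simp add: power2_eq_square)
qed

lemma res_bound: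
  assumes "norm x \<le> B" shows "\<bar>res x i j\<bar> \<le> B\<^sup>2 + (\<Sum>l\<in>UNIV. \<sigma> l)"
proof -
  have "\<bar>cross x i j\<bar> \<le> (norm x)\<^sup>2" by (rule cross_bound)
  moreover have "(norm x)\<^sup>2 \<le> B\<^sup>2" using assms norm_ge_zero by (rule power_mono)
  moreover have "\<bar>target i j\<bar> \<le> \<sigma> i" using \<sigma>_nonneg[of i] by (simp add: target_def)
  moreover have "\<sigma> i \<le> (\<Sum>l\<in>UNIV. \<sigma> l)" by (rule member_le_sum) (simp_all add: \<sigma>_nonneg)
  ultimately show ?thesis unfolding res_def cross_def by linarith
qed

lemma double_sum_bound:
  fixes F :: "'n \<Rightarrow> 'm \<Rightarrow> real"
  assumes "\<And>i j. \<bar>F i j\<bar> \<le> C"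
  shows "\<bar>\<Sum>i\<in>UNIV. \<Sum>j\<in>UNIV. F i j\<bar> \<le> real (CARD('n) * CARD('m)) * C"
proof -
  have "\<bar>\<Sum>i\<in>UNIV. \<Sum>j\<in>UNIV. F i j\<bar> \<le> (\<Sum>i\<in>(UNIV::'n set). \<Sum>j\<in>(UNIV::'m set). \<bar>F i j\<bar>)"
    using sum_mono[OF sum_abs] by (rule order_trans[OF sum_abs])
  also have "\<dots> \<le> (\<Sum>i\<in>(UNIV::'n set). \<Sum>j\<in>(UNIV::'m set). C)"
    by (intro sum_mono assms)
  finally show ?thesis by simp
qed

section \<open>The optimal set: common product, common value, closedness\<close>

lemma optimal_product:
  assumes x: "x \<in> optimal"
  shows "fst x $ i \<bullet> snd x $ j = (if i \<in> T \<and> j = \<pi> i then \<sigma> i - lam else 0)"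
proof (cases "j \<in> range \<pi>")
  case True
  then obtain l where l: "j = \<pi> l" by blast
  then have "snd x $ j = fst x $ l" using x by (simp add: optimal_def)
  moreover have "fst x $ i \<bullet> fst x $ l = (if i \<in> T \<and> l = i then \<sigma> i - lam else 0)"
  proof (cases "i \<in> T \<and> l \<in> T")
    case True
    then show ?thesis using x unfolding optimal_def by simp
  next
    case False
    then have "fst x $ i = 0 \<or> fst x $ l = 0" using x unfolding optimal_def by blast
    then show ?thesis using False by auto
  qed
  ultimately show ?thesis using inj_\<pi> by (simp add: l inj_eq)
next
  case False
  then have "snd x $ j = 0" using x by (simp add: optimal_def)
  then show ?thesis using False by auto
qed

lemma f_optimal:
  assumes "x \<in> optimal" "y \<in> optimal" shows "f x = f y"
  using optimal_norm[OF assms(1)] optimal_norm[OF assms(2)]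
  by (simp add: f_def res_def optimal_product[OF assms(1)] optimal_product[OF assms(2)])

lemma closed_optimal: "closed optimal"
proof -
  have "optimal = (\<Inter>i. {x. snd x $ \<pi> i = fst x $ i}) \<inter> (\<Inter>j\<in>- range \<pi>. {x. snd x $ j = 0})
      \<inter> (\<Inter>i\<in>- T. {x. fst x $ i = 0})
      \<inter> (\<Inter>i\<in>T. \<Inter>j\<in>T. {x. fst x $ i \<bullet> fst x $ j = (if i = j then \<sigma> i - lam else 0)})"
    unfolding optimal_def by blast
  then show ?thesis
    by (simp only:) (intro closed_Int closed_INT ballI closed_Collect_eq continuous_intros)
qed

section \<open>The gradient inequality\<close>

text \<open>The given minimizer is itself optimal, and \<open>f\<close> is constant on
  \<open>optimal\<close>.\<close>

lemma optimal_minimizer: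
  assumes x0: "x0 \<in> global_minimizers f" and x: "x \<in> optimal"
  shows "x \<in> global_minimizers f"
  using x0 x minimizers_optimal f_optimal[of x x0] by (force simp: global_minimizers_def)

text \<open>Along a horizontal \<open>h\<close> the gradient is at least \<kappa> / 2 times |h|,
  while the increase of \<open>f\<close> is at most L |h|^2; squaring gives \<kappa>^2 / (4
  L).\<close>

lemma tube_inequality:
  assumes x0: "x0 \<in> global_minimizers f"
  obtains \<epsilon> \<eta> where "0 < \<epsilon>" "0 < \<eta>"
    "\<And>x h. x \<in> optimal \<Longrightarrow> horizontal x h \<Longrightarrow> norm h \<le> \<epsilon> \<Longrightarrow>
       \<eta> * (f (x + h) - f x) \<le> (norm (grad (x + h)))\<^sup>2"
proof -
  obtain \<kappa> where \<kappa>: "0 < \<kappa>"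
    "\<And>x h. x \<in> optimal \<Longrightarrow> horizontal x h \<Longrightarrow> \<kappa> * (h \<bullet> h) \<le> hess x h"
    using hess_lower_bound by blast
  define B where "B = norm x0"
  define R where "R = B\<^sup>2 + (\<Sum>l\<in>UNIV. \<sigma> l)"
  define K where "K = real (CARD('n) * CARD('m))"
  \<comment> \<open>Collects the bounds for half the Hessian, the cubic term and the quartic term
    when |h| \<le> 1.\<close>
  define L where "L = (K * (4 * B\<^sup>2 + 2 * R) + lam) / 2 + K * (2 * B) + K"
  have "0 \<le> B" "0 \<le> R" "1 \<le> K"
    using \<sigma>_nonneg by (auto simp: B_def R_def K_def sum_nonneg Suc_le_eq simp flip: of_nat_mult)
  then have "0 < L" using lam_pos by (auto simp: L_def intro!: add_nonneg_pos)
  \<comment> \<open>Chosen so that three times the cubic term is at most \<kappa> / 2 times |h|^2; B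
    + 1 replaces B, which may be 0.\<close>
  define \<epsilon> where "\<epsilon> = min 1 (\<kappa> / (12 * K * (B + 1)))"
  have \<epsilon>: "0 < \<epsilon>" "\<epsilon> \<le> 1" "\<epsilon> \<le> \<kappa> / (12 * K * (B + 1))"
    using \<kappa> \<open>0 \<le> B\<close> \<open>1 \<le> K\<close> by (auto simp: \<epsilon>_def)
  show ?thesis
  proof (rule that[of \<epsilon> "\<kappa>\<^sup>2 / (4 * L)"])
    show "0 < \<epsilon>" "0 < \<kappa>\<^sup>2 / (4 * L)" using \<epsilon> \<kappa> \<open>0 < L\<close> by auto
    fix x h assume x: "x \<in> optimal" and hor: "horizontal x h" and small: "norm h \<le> \<epsilon>"
    \<comment> \<open>All optimal points have this norm, so the constants do not depend on
      \<open>x\<close>.\<close>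
    have "norm x = B"
      using optimal_norm[OF x] optimal_norm[of x0] minimizers_optimal x0
      by (auto simp: B_def norm_eq_sqrt_inner)
    then have xB: "norm x \<le> B" by simp
    note gx = grad_minimizer[OF optimal_minimizer[OF x0 x]]
    define n where "n = norm h"
    have n: "0 \<le> n" "n \<le> \<epsilon>" "n \<le> 1" "h \<bullet> h = n\<^sup>2"
      using small \<epsilon> by (auto simp: n_def power2_norm_eq_inner)
    define C3 where "C3 = (\<Sum>i\<in>UNIV. \<Sum>j\<in>UNIV. lin x h i j * cross h i j)"
    define C4 where "C4 = (\<Sum>i\<in>UNIV. \<Sum>j\<in>UNIV. (cross h i j)\<^sup>2)"
    have "\<bar>C3\<bar> \<le> K * (2 * B * n * n\<^sup>2)"
      unfolding C3_def K_def abs_mult n_def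
      by (intro double_sum_bound) (simp add: abs_mult mult_mono lin_bound[OF xB] cross_bound \<open>0 \<le> B\<close>)
    then have C3: "\<bar>C3\<bar> \<le> K * (2 * B) * n * n\<^sup>2" by (simp add: mult.assoc)
    have C4: "0 \<le> C4" by (simp add: C4_def sum_nonneg)
    have "\<bar>C4\<bar> \<le> K * (n\<^sup>2)\<^sup>2"
      unfolding C4_def K_def n_def
    proof (intro double_sum_bound)
      show "\<bar>(cross h i j)\<^sup>2\<bar> \<le> ((norm h)\<^sup>2)\<^sup>2" for i j
        using power_mono[OF cross_bound[of h i j] abs_ge_zero, of 2] by simp
    qed
    also have "\<dots> \<le> K * n\<^sup>2"
    proof -
      have "n\<^sup>2 * n\<^sup>2 \<le> n\<^sup>2" using n by (intro mult_left_le power_le_one) auto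
      then show ?thesis using \<open>1 \<le> K\<close> unfolding power2_eq_square[of "n\<^sup>2"] by (intro mult_left_mono) auto
    qed
    finally have C4': "C4 \<le> K * n\<^sup>2" by simp
    have lower: "\<kappa> / 2 * n\<^sup>2 \<le> grad (x + h) \<bullet> h"
    proof -
      have "3 * (K * (2 * B) * n) \<le> 3 * (K * (2 * (B + 1)) * \<epsilon>)"
        using n \<open>0 \<le> B\<close> \<open>1 \<le> K\<close> by (intro mult_left_mono mult_mono) auto
      also have "\<dots> \<le> 3 * (K * (2 * (B + 1)) * (\<kappa> / (12 * K * (B + 1))))"
        using \<epsilon> \<open>0 \<le> B\<close> \<open>1 \<le> K\<close> by (intro mult_left_mono) auto
      also have "\<dots> = \<kappa> / 2"
      proof -
        have *: "3 * (K * (2 * c) * (\<kappa> / (12 * K * c))) = \<kappa> / 2" if "c \<noteq> 0" for c :: real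
          using that \<open>1 \<le> K\<close> by (simp add: field_simps)
        show ?thesis by (rule *) (use \<open>0 \<le> B\<close> in simp)
      qed
      finally have "3 * (K * (2 * B) * n) * n\<^sup>2 \<le> \<kappa> / 2 * n\<^sup>2"
        by (intro mult_right_mono) auto
      moreover have "grad (x + h) \<bullet> h = hess x h + 3 * C3 + 2 * C4"
        unfolding grad_expand gx C3_def C4_def by simp
      moreover have "\<kappa> * n\<^sup>2 \<le> hess x h" using \<kappa>(2)[OF x hor] n by simp
      ultimately show ?thesis using C3 C4 by linarith
    qed
    have "\<kappa> / 2 * n \<le> norm (grad (x + h))"
    proof (cases "n = 0")
      case False
      have "\<kappa> / 2 * n * n \<le> norm (grad (x + h)) * n"
        using lower Cauchy_Schwarz_ineq2[of "grad (x + h)" h]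
        by (simp add: n_def power2_eq_square mult.assoc)
      then show ?thesis using False n by simp
    qed simp
    then have grad_lower: "\<kappa>\<^sup>2 / 4 * n\<^sup>2 \<le> (norm (grad (x + h)))\<^sup>2"
      using power_mono[of "\<kappa> / 2 * n" _ 2] \<kappa> n by (simp add: power_mult_distrib power_divide)
    have "hess x h \<le> (K * (4 * B\<^sup>2 + 2 * R) + lam) * n\<^sup>2"
    proof -
      have entry: "\<bar>(lin x h i j)\<^sup>2 + 2 * res x i j * cross h i j\<bar> \<le> (2 * B * n)\<^sup>2 + 2 * R * n\<^sup>2" for i j
      proof -
        have "(lin x h i j)\<^sup>2 \<le> (2 * B * n)\<^sup>2"
          using lin_bound[OF xB] n_def by (metis abs_ge_zero power2_abs power_mono)
        moreover have "\<bar>res x i j * cross h i j\<bar> \<le> R * n\<^sup>2"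
          unfolding abs_mult n_def
          using res_bound[OF xB, folded R_def] cross_bound \<open>0 \<le> R\<close> by (intro mult_mono) simp_all
        moreover have "0 \<le> (lin x h i j)\<^sup>2" by simp
        ultimately show ?thesis by linarith
      qed
      have "(\<Sum>i\<in>UNIV. \<Sum>j\<in>UNIV. (lin x h i j)\<^sup>2 + 2 * res x i j * cross h i j)
          \<le> K * ((2 * B * n)\<^sup>2 + 2 * R * n\<^sup>2)"
        unfolding K_def by (rule abs_le_D1[OF double_sum_bound]) (rule entry)
      also have "\<dots> = K * (4 * B\<^sup>2 + 2 * R) * n\<^sup>2"
        by (simp add: power_mult_distrib algebra_simps)
      finally show ?thesis
        unfolding hess_def n(4) by (simp add: distrib_right)
    qed
    moreover have "C3 \<le> K * (2 * B) * n\<^sup>2"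
    proof -
      have "K * (2 * B) * n * n\<^sup>2 \<le> K * (2 * B) * 1 * n\<^sup>2"
        using n \<open>0 \<le> B\<close> \<open>1 \<le> K\<close> by (intro mult_right_mono mult_left_mono) auto
      then show ?thesis using C3 by linarith
    qed
    moreover have "f (x + h) - f x = hess x h / 2 + C3 + C4 / 2"
      unfolding f_expand gx C3_def C4_def by simp
    moreover have "L * n\<^sup>2 = (K * (4 * B\<^sup>2 + 2 * R) + lam) * n\<^sup>2 / 2 + K * (2 * B) * n\<^sup>2 + K * n\<^sup>2"
      unfolding L_def by (simp add: distrib_right)
    ultimately have "f (x + h) - f x \<le> L * n\<^sup>2"
      using C4' C4 by linarith
    then have "\<kappa>\<^sup>2 / (4 * L) * (f (x + h) - f x) \<le> \<kappa>\<^sup>2 / (4 * L) * (L * n\<^sup>2)"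
      using \<open>0 < L\<close> by (intro mult_left_mono) auto
    also have "\<dots> = \<kappa>\<^sup>2 / 4 * n\<^sup>2" using \<open>0 < L\<close> by simp
    finally show "\<kappa>\<^sup>2 / (4 * L) * (f (x + h) - f x) \<le> (norm (grad (x + h)))\<^sup>2"
      using grad_lower by linarith
  qed
qed

theorem gradient_inequality_ball:
  assumes x0: "x0 \<in> global_minimizers f" and \<rho>: "\<And>i. i \<in> T \<Longrightarrow> \<rho>\<^sup>2 < \<sigma> i - lam"
  shows "\<exists>\<eta>>0. \<forall>z\<in>cball x0 \<rho>. \<eta> * (f z - f x0) \<le> (norm (gradient f z))\<^sup>2"
proof -
  obtain \<epsilon> \<eta>1 where \<epsilon>: "0 < \<epsilon>" and \<eta>1: "0 < \<eta>1" and tube: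
    "\<And>x h. x \<in> optimal \<Longrightarrow> horizontal x h \<Longrightarrow> norm h \<le> \<epsilon> \<Longrightarrow>
       \<eta>1 * (f (x + h) - f x) \<le> (norm (grad (x + h)))\<^sup>2"
    using tube_inequality[OF x0] by blast
  have x0_opt: "x0 \<in> optimal" using minimizers_optimal x0 by blast
  then have ne: "optimal \<noteq> {}" by blast
  have min: "f x0 \<le> f z" for z using x0 unfolding global_minimizers_def by blast
  define K where "K = cball x0 \<rho> \<inter> {z. \<epsilon> \<le> infdist z optimal}"
  have "compact K"
    unfolding K_def by (intro compact_Int_closed compact_cball closed_Collect_le continuous_intros)
  obtain \<eta>2 where \<eta>2: "0 < \<eta>2" "\<And>z. z \<in> K \<Longrightarrow> \<eta>2 * (f z - f x0) \<le> (norm (grad z))\<^sup>2"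
  proof (cases "K = {}")
    case False
    \<comment> \<open>A critical point in the ball has independent rows and is optimal, hence at
      distance 0 from \<open>optimal\<close> and not in \<open>K\<close>.\<close>
    have nz: "grad z \<noteq> 0" if "z \<in> K" for z
    proof
      assume "grad z = 0"
      have "(dist z x0)\<^sup>2 \<le> \<rho>\<^sup>2"
        using that by (intro power_mono) (auto simp: K_def dist_commute)
      then have "rows_independent z"
        using \<rho> by (intro near_optimal_rows_independent[OF x0_opt]) force
      then have "z \<in> optimal" using critical_independent_optimal \<open>grad z = 0\<close> by blast
      then show False using that \<epsilon> by (simp add: K_def)
    qed
    have "continuous_on K (\<lambda>z. (norm (grad z))\<^sup>2)"
      by (intro continuous_intros continuous_grad)
    then obtain a where a: "a \<in> K" "\<And>z. z \<in> K \<Longrightarrow> (norm (grad a))\<^sup>2 \<le> (norm (grad z))\<^sup>2"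
      using continuous_attains_inf[OF \<open>compact K\<close> False] by blast
    obtain b where b: "b \<in> K" "\<And>z. z \<in> K \<Longrightarrow> f z \<le> f b"
      using continuous_attains_sup[OF \<open>compact K\<close> False continuous_f] by blast
    \<comment> \<open>Adding 1 keeps the divisor positive even if \<open>f\<close> does not exceed
      its minimum on \<open>K\<close>.\<close>
    define M where "M = f b - f x0 + 1"
    have M: "0 < M" "\<And>z. z \<in> K \<Longrightarrow> f z - f x0 \<le> M" using min[of b] b by (auto simp: M_def) (force)
    show ?thesis
    proof (rule that[of "(norm (grad a))\<^sup>2 / M"])
      show "0 < (norm (grad a))\<^sup>2 / M" using nz[OF a(1)] M by simp
      fix z assume z: "z \<in> K"
      have "(norm (grad a))\<^sup>2 / M * (f z - f x0) \<le> (norm (grad a))\<^sup>2 / M * M"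
        using M z by (intro mult_left_mono) auto
      also have "\<dots> \<le> (norm (grad z))\<^sup>2" using M a z by simp
      finally show "(norm (grad a))\<^sup>2 / M * (f z - f x0) \<le> (norm (grad z))\<^sup>2" .
    qed
  qed (use that[of 1] in simp)
  have "min \<eta>1 \<eta>2 * (f z - f x0) \<le> (norm (grad z))\<^sup>2" if z: "z \<in> cball x0 \<rho>" for z
  proof (cases "\<epsilon> \<le> infdist z optimal")
    case True
    have "min \<eta>1 \<eta>2 * (f z - f x0) \<le> \<eta>2 * (f z - f x0)"
      using min[of z] by (intro mult_right_mono) auto
    also have "\<dots> \<le> (norm (grad z))\<^sup>2" using True z by (intro \<eta>2) (simp add: K_def)
    finally show ?thesis .
  next
    case False
    obtain x where x: "x \<in> optimal" and closest: "\<And>y. y \<in> optimal \<Longrightarrow> dist z x \<le> dist z y"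
      using distance_attains_inf[OF closed_optimal ne] by blast
    have "dist z x \<le> infdist z optimal"
      unfolding infdist_notempty[OF ne] by (intro cINF_greatest ne closest)
    then have small: "norm (z - x) \<le> \<epsilon>" using False by (simp add: dist_norm)
    have "horizontal x (z - x)" using closest_horizontal[OF x, of "z - x"] closest by simp
    then have "\<eta>1 * (f z - f x) \<le> (norm (grad z))\<^sup>2" using tube[OF x _ small] by simp
    moreover have "min \<eta>1 \<eta>2 * (f z - f x0) \<le> \<eta>1 * (f z - f x0)"
      using min[of z] by (intro mult_right_mono) auto
    ultimately show ?thesis using f_optimal[OF x x0_opt] by simp
  qed
  then show ?thesis
    using \<eta>1 \<eta>2 by (intro exI[of _ "min \<eta>1 \<eta>2"]) (simp add: gradient_f)
qed

end

section \<open>Singular values of rectangular diagonal matrices\<close>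

lemma strict_mono_position: "i < j \<Longrightarrow> position i < position j"
  unfolding position_def by (intro psubset_card_mono) (auto simp: psubset_eq)

lemma inj_position: "inj position"
  by (metis injI less_irrefl linorder_less_linear strict_mono_position)

lemma range_position: "range (position :: 'a::{finite,linorder} \<Rightarrow> nat) = {1..CARD('a)}"
proof (rule card_subset_eq)
  have "position i \<in> {1..CARD('a)}" for i :: 'a
    unfolding position_def by (auto simp: Suc_le_eq card_gt_0_iff intro!: card_mono)
  then show "range (position :: 'a \<Rightarrow> nat) \<subseteq> {1..CARD('a)}" by blast
qed (simp_all add: card_image inj_position)

lemma position_bounds: "1 \<le> position (i :: 'a::{finite,linorder})" "position i \<le> CARD('a)"
  using range_position[where 'a='a] by auto

text \<open>Evaluation is a ring homomorphism, so it commutes with the Leibniz formula.\<close>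

lemma poly_charpoly: "poly (charpoly A) x = det (mat x - A)"
proof -
  have "poly (if i = j then [: - (A $ i $ j), 1 :] else [: - (A $ i $ j) :]) x = (mat x - A) $ i $ j" for i j
    by (simp add: mat_def)
  then show ?thesis
    by (simp add: charpoly_def det_def poly_sum poly_prod)
qed

text \<open>A root has a real eigenvector v, and x |v|^2 = |A^T v|^2.\<close>

lemma charpoly_gram_root_nonneg:
  fixes A :: "real^'m^'n"
  assumes "poly (charpoly (A ** transpose A)) x = 0"
  shows "0 \<le> x"
proof -
  have "det (mat x - A ** transpose A) = 0" using assms by (simp add: poly_charpoly)
  then have "\<not> (\<forall>v. (mat x - A ** transpose A) *v v = 0 \<longrightarrow> v = 0)"
    by (simp only: matrix_left_invertible_ker[symmetric] invertible_left_inverse[symmetric] invertible_det_nz not_not)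
  then obtain v where v: "v \<noteq> 0" "(mat x - A ** transpose A) *v v = 0"
    by blast
  have "mat x *v v = x *\<^sub>R v"
    by (simp add: vec_eq_iff matrix_vector_mult_def mat_def if_distrib[where f="\<lambda>t. t * _"] cong: if_cong)
  then have "x *\<^sub>R v = A *v (transpose A *v v)"
    using v(2) by (simp add: matrix_vector_mult_diff_rdistrib matrix_vector_mul_assoc del: transpose_matrix_vector)
  then have "x * (v \<bullet> v) = v \<bullet> (A *v (transpose A *v v))" by (metis inner_scaleR_right)
  also have "\<dots> = (transpose A *v v) \<bullet> (transpose A *v v)"
    by (simp add: dot_lmul_matrix)
  finally have "0 \<le> x * (v \<bullet> v)" by simp
  moreover have "0 < v \<bullet> v" using v(1) by simp
  ultimately show ?thesis by (simp add: zero_le_mult_iff)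
qed

lemma singular_values_nonneg: "x \<in> set (singular_values A) \<Longrightarrow> 0 \<le> x"
  using charpoly_gram_root_nonneg[of A]
  \<comment> \<open>For the zero polynomial \<open>proots\<close> is empty; otherwise its elements
    are the roots.\<close>
  by (cases "charpoly (A ** transpose A) = 0") (auto simp: singular_values_def)

lemma singular_value_nonneg: "0 \<le> singular_value A i"
  using singular_values_nonneg[of _ A] by (simp add: singular_value_def nth_default_def)

lemma singular_value_antimono:
  assumes "i \<le> j" shows "singular_value A j \<le> singular_value A i"
proof (cases "j - 1 < length (singular_values A)")
  case True
  have "sorted_wrt (\<ge>) (singular_values A)"
    by (simp add: singular_values_def sorted_wrt_rev)
  then show ?thesis
    \<comment> \<open>Truncated subtraction sends indices 0 and 1 to the same entry, so equal list
      positions need their own case.\<close>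
    using True assms by (cases "i - 1 = j - 1") (auto simp: singular_value_def nth_default_def sorted_wrt_iff_nth_less)
next
  case False
  then show ?thesis using singular_value_nonneg[of A i] by (simp add: singular_value_def nth_default_beyond)
qed

text \<open>With no more rows than columns, every row has a column \<open>k0\<close> at its own
  position, the only one contributing to the sum.\<close>

lemma rect_diag_gram:
  fixes D :: "real^('m::{finite,linorder})^('n::{finite,linorder})"
  assumes D: "D = rect_diag d" and card: "CARD('n) \<le> CARD('m)"
  shows "D ** transpose D =
    (\<chi> i j. if i = j then (d (position i))\<^sup>2 else 0)"
proof -
  have "(\<Sum>k\<in>UNIV. D $ i $ k * D $ j $ k)
      = (if i = j then (d (position i))\<^sup>2 else 0)" for i j
  proof -
    have "position i \<in> range (position :: 'm \<Rightarrow> nat)"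
      using position_bounds[of i] card by (simp add: range_position)
    then obtain k0 :: 'm where k0: "position i = position k0" by auto
    have "D $ i $ k * D $ j $ k
        = (if k = k0 then (if i = j then (d (position i))\<^sup>2 else 0) else 0)" for k
    proof -
      have "position i = position k \<longleftrightarrow> k = k0"
        using k0 by (auto simp: inj_eq[OF inj_position])
      moreover have "position j = position k0 \<longleftrightarrow> i = j"
        using k0[symmetric] by (auto simp: inj_eq[OF inj_position])
      ultimately show ?thesis by (auto simp: D rect_diag_def power2_eq_square)
    qed
    then show ?thesis by simp
  qed
  then show ?thesis
    by (simp add: vec_eq_iff matrix_matrix_mult_def transpose_def)
qed

text \<open>The Gram matrix is diagonal, so its characteristic polynomial splits into linear factors
  with roots d^2; the roots d are already listed in nonincreasing order.\<close>

lemma singular_values_rect_diag: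
  fixes D :: "real^('m::{finite,linorder})^('n::{finite,linorder})"
  assumes D: "D = rect_diag d" and card: "CARD('n) \<le> CARD('m)"
    and nonneg: "\<And>i. 0 \<le> d i" and antimono: "\<And>i j. i \<le> j \<Longrightarrow> d j \<le> d i"
  shows "singular_values D = map d [1..<CARD('n) + 1]"
proof -
  have "charpoly (D ** transpose D) = (\<Prod>i\<in>(UNIV::'n set). [:- ((d (position i))\<^sup>2), 1:])"
    unfolding charpoly_def rect_diag_gram[OF D card] by (subst det_diagonal) auto
  then have "proots (charpoly (D ** transpose D)) = (\<Sum>i\<in>(UNIV::'n set). {#(d (position i))\<^sup>2#})"
    by (simp add: proots_prod)
  also have "\<dots> = image_mset (\<lambda>i. (d (position i))\<^sup>2) (mset_set (UNIV::'n set))"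
    by (simp add: sum_unfold_sum_mset)
  finally have "image_mset sqrt (proots (charpoly (D ** transpose D)))
      = image_mset d (image_mset position (mset_set (UNIV::'n set)))"
    by (simp add: image_mset.compositionality o_def nonneg)
  also have "image_mset position (mset_set (UNIV::'n set)) = mset_set {1..CARD('n)}"
    by (simp add: image_mset_mset_set inj_position range_position)
  also have "\<dots> = mset [1..<CARD('n) + 1]"
    unfolding mset_upt by (simp add: atLeastLessThanSuc_atLeastAtMost)
  finally have "image_mset sqrt (proots (charpoly (D ** transpose D))) = mset (map d [1..<CARD('n) + 1])"
    by simp
  then have "singular_values D = rev (sort (map d [1..<CARD('n) + 1]))"
    by (simp only: singular_values_def sorted_list_of_multiset_mset)
  also have "sort (map d [1..<CARD('n) + 1]) = rev (map d [1..<CARD('n) + 1])"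
  proof (intro properties_for_sort)
    have "sorted_wrt (\<lambda>x y. y \<le> x) (map d [1..<CARD('n) + 1])"
      by (auto simp: sorted_wrt_map sorted_wrt_iff_nth_less intro!: antimono simp del: upt_Suc)
    then show "sorted (rev (map d [1..<CARD('n) + 1]))"
      by (simp only: sorted_wrt_rev)
  qed simp
  finally show ?thesis by simp
qed

lemma singular_value_rect_diag:
  fixes D :: "real^('m::{finite,linorder})^('n::{finite,linorder})"
  assumes D: "D = rect_diag d" and card: "CARD('n) \<le> CARD('m)"
    and "\<And>i. 0 \<le> d i" and "\<And>i j. i \<le> j \<Longrightarrow> d j \<le> d i"
    and i: "1 \<le> i" "i \<le> CARD('n)"
  shows "singular_value D i = d i"
proof -
  have "singular_values D = map d [1..<CARD('n) + 1]"
    by (rule singular_values_rect_diag[OF D card]) (fact assms)+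
  then show ?thesis
    using i by (simp add: singular_value_def nth_default_nth del: upt_Suc)
qed

section \<open>Transfer to the matrix objective\<close>

lemma (in factorization) f_eq_Phi:
  assumes "\<And>i j. S $ i $ j = target i j"
  shows "f = Phi S lam"
proof
  fix x :: "(real^'r^'n) \<times> (real^'r^'m)"
  define R where "R = fst x ** transpose (snd x) - S"
  have "R $ i $ j = res x i j" for i j
    by (simp add: R_def matrix_matrix_mult_def transpose_def res_def assms inner_vec_def)
  then have "(norm R)\<^sup>2 = (\<Sum>i\<in>UNIV. \<Sum>j\<in>UNIV. (res x i j)\<^sup>2)"
    unfolding power2_norm_eq_inner inner_vec_def by (simp add: power2_eq_square)
  moreover have "x \<bullet> x = (norm (fst x))\<^sup>2 + (norm (snd x))\<^sup>2"
    by (simp add: inner_prod_def power2_norm_eq_inner)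
  ultimately show "f x = Phi S lam x"
    by (simp add: f_def Phi_def R_def split_beta)
qed

theorem theorem4p1:
  fixes M Mstar E Sigma :: "real^('m::{finite,linorder})^('n::{finite,linorder})"
    and Sigma1 :: "real^('r::{finite,linorder})^('r::{finite,linorder})"
    and st :: "nat \<Rightarrow> real" and s k :: nat and lam :: real
    and Ubar :: "real^('r::{finite,linorder})^('n::{finite,linorder})"
    and Vbar :: "real^('r::{finite,linorder})^('m::{finite,linorder})"
  assumes "CARD('n) \<le> CARD('m)"
    and "M = Mstar + E"
    and "rank Mstar = CARD('r)"
    and "4 * CARD('r) \<le> min CARD('m) CARD('n)"
    and "Sigma = rect_diag (singular_value M)"
    and "Sigma1 = rect_diag (singular_value M)"
    and "singular_value Sigma CARD('r) > singular_value Sigma (CARD('r) + 1)"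
    and "1 \<le> s" and "s \<le> CARD('r)"
    and "strict_antimono_on {1..s} st"
    and "st ` {1..s} = singular_value Sigma1 ` {1..CARD('r)}"
    and "st (s + 1) = 0"
    and "k \<le> s"
    and "lam > 0"
    and "st (k + 1) < lam"
    and "ereal lam < (if k = 0 then \<infinity> else ereal (st k))"
    and "(Ubar, Vbar) \<in> global_minimizers (Phi Sigma lam)"
  shows "\<exists>\<eta>>0. \<forall>\<delta>::real.
    ereal \<delta> \<le> Min {if k = 0 then \<infinity> else ereal (sqrt (st k - lam) / 2),
                    ereal ((lam - st (k + 1)) / (2 * sqrt (st 1))),
                    ereal ((st s - singular_value Sigma (CARD('r) + 1)) / (4 * sqrt (st 1)))} \<longrightarrow>
    (\<forall>(U, V) \<in> cball (Ubar, Vbar) \<delta>.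
       (norm (gradient (Phi Sigma lam) (U, V)))\<^sup>2
         \<ge> \<eta> * (Phi Sigma lam (U, V) - Phi Sigma lam (Ubar, Vbar)))"
proof -
  define r where "r = CARD('r)"
  define d where "d = singular_value M"
  have d_nonneg: "0 \<le> d i" and d_antimono: "i \<le> j \<Longrightarrow> d j \<le> d i" for i j
    by (auto simp: d_def singular_value_nonneg singular_value_antimono)
  have r: "1 \<le> r" "r + 1 \<le> CARD('n)"
  proof -
    have "4 * CARD('r) \<le> CARD('n)" "0 < CARD('r)" using assms(4) by simp_all
    then show "1 \<le> r" "r + 1 \<le> CARD('n)" unfolding r_def by linarith+
  qed
  have sv_Sigma: "singular_value Sigma i = d i" if "1 \<le> i" "i \<le> CARD('n)" for i
    using that assms(1,5) d_nonneg d_antimono by (intro singular_value_rect_diag) (simp_all add: d_def)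
  have sv_Sigma1: "singular_value Sigma1 i = d i" if "1 \<le> i" "i \<le> r" for i
    using that assms(6) d_nonneg d_antimono by (intro singular_value_rect_diag) (simp_all add: d_def r_def)
  have d_gap: "d (r + 1) < d r"
    using assms(7) r sv_Sigma[of r] sv_Sigma[of "r + 1"] by (simp add: r_def)
  have st_image: "st ` {1..s} = d ` {1..r}"
    unfolding assms(11) using sv_Sigma1 by (intro image_cong) (auto simp: r_def)
  have st_less: "st b < st a" if "1 \<le> a" "a < b" "b \<le> s" for a b
    using assms(10) that by (auto simp: monotone_on_def)
  have st_le: "st b \<le> st a" if "1 \<le> a" "a \<le> b" "b \<le> s" for a b
    using st_less[of a b] that by (cases "a = b") auto
  have st_k: "lam < st k" if "1 \<le> k"
    using assms(16) that by simp
  have d_st: "\<exists>t\<in>{1..s}. d i = st t" if "1 \<le> i" "i \<le> r" for i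
    using st_image that by (metis atLeastAtMost_iff imageE imageI)
  \<comment> \<open>None of the first r singular values lies in [lam, st k), and if k = 0 none
    reaches \<open>lam\<close>.\<close>
  have d_above: "1 \<le> k \<and> st k \<le> d i" if i: "1 \<le> i" "i \<le> r" and "lam \<le> d i" for i
  proof -
    obtain t where t: "1 \<le> t" "t \<le> s" "d i = st t" using d_st[OF i] by auto
    have "t \<le> k"
    proof (rule ccontr)
      assume "\<not> t \<le> k"
      then have "st t \<le> st (k + 1)" using t by (intro st_le) auto
      then show False using assms(15) \<open>lam \<le> d i\<close> t by simp
    qed
    then show ?thesis using t st_le[of t k] assms(13) by simp
  qed
  define \<pi> :: "'n \<Rightarrow> 'm" where "\<pi> i = inv position (position i)" for i
  have position_\<pi>: "position (\<pi> i) = position i" for i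
    unfolding \<pi>_def using position_bounds[of i] assms(1)
    by (intro f_inv_into_f) (simp add: range_position)
  define \<sigma> :: "'n \<Rightarrow> real" where "\<sigma> i = d (position i)" for i
  \<comment> \<open>The bound on the position caps the number of surviving rows at r, the number of
    columns of the factors.\<close>
  define T :: "'n set" where "T = {i. position i \<le> r \<and> lam < \<sigma> i}"
  have T_card: "card T \<le> r"
  proof -
    have "card T = card (position ` T)"
      by (metis card_image inj_on_subset inj_position subset_UNIV)
    also have "\<dots> \<le> card {1..r}"
      using position_bounds by (intro card_mono) (auto simp: T_def)
    finally show ?thesis by simp
  qed
  interpret factorization \<pi> \<sigma> lam T "TYPE('r)"
  proof
    show "inj \<pi>" by (metis injI inj_eq inj_position position_\<pi>)
    show "0 \<le> \<sigma> i" for i by (simp add: \<sigma>_def d_nonneg)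
    show "0 < lam" by (fact assms(14))
    show "lam < \<sigma> i" if "i \<in> T" for i using that by (simp add: T_def)
    show "\<sigma> j < \<sigma> i" if "i \<in> T" "j \<notin> T" for i j
    proof (cases "position j \<le> r")
      case False
      then have "\<sigma> j \<le> d (r + 1)" by (auto simp: \<sigma>_def intro: d_antimono)
      also note d_gap
      also have "d r \<le> \<sigma> i" using that by (auto simp: \<sigma>_def T_def intro: d_antimono)
      finally show ?thesis .
    qed (use that in \<open>auto simp: T_def\<close>)
    show "card T \<le> CARD('r)" using T_card by (simp add: r_def)
    \<comment> \<open>If k = s, the first r singular values all exceed \<open>lam\<close> and fill
      \<open>T\<close>. Otherwise st (k + 1) is attained within the first r, so everything outside
      \<open>T\<close> is below \<open>lam\<close>.\<close>
    show "(\<forall>j. j \<notin> T \<longrightarrow> \<sigma> j < lam) \<or> card T = CARD('r)"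
    proof (cases "k = s")
      case True
      have "d i > lam" if i: "1 \<le> i" "i \<le> r" for i
      proof -
        obtain t where "t \<in> {1..s}" "d i = st t" using d_st[OF i] by auto
        then show ?thesis using st_le[of t k] st_k assms(8) True by auto
      qed
      then have "T = position -` {1..r}"
        using position_bounds(1) by (auto simp: T_def \<sigma>_def)
      moreover have "card (position -` {1..r} :: 'n set) = card {1..r}"
        using r by (intro card_vimage_inj inj_position) (auto simp: range_position)
      ultimately show ?thesis by (simp add: r_def)
    next
      case False
      then have k: "k + 1 \<le> s" using assms(13) by simp
      obtain a where a: "a \<in> {1..r}" "st (k + 1) = d a"
        using st_image k by (metis atLeastAtMost_iff imageE imageI le_add2)
      have "\<sigma> j < lam" if "j \<notin> T" for j
      proof (cases "position j \<le> r")
        case True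
        show ?thesis
        proof (rule ccontr)
          assume "\<not> \<sigma> j < lam"
          then have "1 \<le> k \<and> st k \<le> \<sigma> j"
            unfolding \<sigma>_def using True position_bounds(1)[of j] by (intro d_above) auto
          then show False using st_k True that by (auto simp: T_def)
        qed
      next
        case False
        then have "\<sigma> j \<le> d (r + 1)" by (auto simp: \<sigma>_def intro: d_antimono)
        also note d_gap
        also have "d r \<le> d a" using a by (intro d_antimono) auto
        also have "\<dots> < lam" using assms(15) a by simp
        finally show ?thesis .
      qed
      then show ?thesis by blast
    qed
  qed
  have f_eq: "f = Phi Sigma lam"
  proof (rule f_eq_Phi)
    fix i j
    have "position i = position j \<longleftrightarrow> j = \<pi> i"
      using position_\<pi>[of i] by (metis inj_eq inj_position)
    then show "Sigma $ i $ j = target i j"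
      by (simp add: assms(5) rect_diag_def target_def \<sigma>_def d_def)
  qed
  \<comment> \<open>If k = 0 then \<open>T\<close> is empty and any radius meets the requirement
    below; otherwise \<rho>^2 is a quarter of st k - lam. In both cases \<rho> is a member of the
    minimum bounding \<delta>, so one \<eta> serves every admissible \<delta>.\<close>
  define \<rho> where "\<rho> = (if k = 0 then (lam - st (k + 1)) / (2 * sqrt (st 1)) else sqrt (st k - lam) / 2)"
  have "\<exists>\<eta>>0. \<forall>z\<in>cball (Ubar, Vbar) \<rho>. \<eta> * (f z - f (Ubar, Vbar)) \<le> (norm (gradient f z))\<^sup>2"
  proof (rule gradient_inequality_ball)
    show "(Ubar, Vbar) \<in> global_minimizers f" using assms(17) by (simp add: f_eq)
    fix i assume "i \<in> T"
    then have k: "1 \<le> k" "st k \<le> \<sigma> i"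
      using d_above[of "position i"] position_bounds(1)[of i] by (auto simp: T_def \<sigma>_def)
    then have "\<rho>\<^sup>2 = (st k - lam) / 4" using st_k by (simp add: \<rho>_def power_divide)
    then show "\<rho>\<^sup>2 < \<sigma> i - lam" using k st_k by simp
  qed
  then obtain \<eta> where "\<eta> > 0" and \<eta>: "\<And>z. z \<in> cball (Ubar, Vbar) \<rho> \<Longrightarrow>
      \<eta> * (Phi Sigma lam z - Phi Sigma lam (Ubar, Vbar)) \<le> (norm (gradient (Phi Sigma lam) z))\<^sup>2"
    unfolding f_eq by blast
  show ?thesis
  proof (intro exI conjI allI impI)
    show "\<eta> > 0" by fact
    fix \<delta> :: real
    assume "ereal \<delta> \<le> Min {if k = 0 then \<infinity> else ereal (sqrt (st k - lam) / 2),
                    ereal ((lam - st (k + 1)) / (2 * sqrt (st 1))),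
                    ereal ((st s - singular_value Sigma (CARD('r) + 1)) / (4 * sqrt (st 1)))}"
    then have "\<delta> \<le> \<rho>" by (auto simp: \<rho>_def)
    then have "cball (Ubar, Vbar) \<delta> \<subseteq> cball (Ubar, Vbar) \<rho>" by (rule subset_cball)
    then show "\<forall>(U, V) \<in> cball (Ubar, Vbar) \<delta>.
       (norm (gradient (Phi Sigma lam) (U, V)))\<^sup>2
         \<ge> \<eta> * (Phi Sigma lam (U, V) - Phi Sigma lam (Ubar, Vbar))"
      using \<eta> by blast
  qed
qed

end
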